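(* Let $\Omega\subset\mathbb R^n$, $n\ge2$, be a bounded domain with smooth boundary. If $q,q_1,q_2\in C^\infty(\overline\Omega;\mathbb R)$ are nonnegative and \[ G_q=\tau G_{q_1}+(1-\tau)G_{q_2} \] for some $0<\tau<1$, then $q=q_1=q_2$ in $\Omega$.
   Context: For a nonnegative $q\in C^\infty(\overline\Omega;\mathbb R)$, $G_q=(-\Delta_D+q)^{-1}$ is the inverse on $L^2(\Omega)$ of the Dirichlet realization of $-\Delta+q$. *)

theory Defs
  imports "HOL-Analysis.Analysis"
begin

subsection \<open>Smooth functions on open sets\<close>

definition partial_deriv ::
    "'a::euclidean_space \<Rightarrow> ('a \<Rightarrow> 'b::real_normed_vector) \<Rightarrow> 'a \<Rightarrow> 'b" where
  "partial_deriv i f x = frechet_derivative f (at x) i"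

text \<open>Meant for open \<open>S\<close>; the vectors \<open>i \<in> Basis\<close> are the coordinate directions.\<close>

primrec Ck_on ::
    "nat \<Rightarrow> 'a::euclidean_space set \<Rightarrow> ('a \<Rightarrow> 'b::real_normed_vector) \<Rightarrow> bool" where
  "Ck_on 0 S f \<longleftrightarrow> continuous_on S f"
| "Ck_on (Suc k) S f \<longleftrightarrow>
     f differentiable_on S \<and> (\<forall>i\<in>Basis. Ck_on k S (partial_deriv i f))"

definition smooth_on ::
    "'a::euclidean_space set \<Rightarrow> ('a \<Rightarrow> 'b::real_normed_vector) \<Rightarrow> bool" where
  "smooth_on S f \<longleftrightarrow> (\<forall>k. Ck_on k S f)"

definition laplacian ::
    "('a::euclidean_space \<Rightarrow> 'b::real_normed_vector) \<Rightarrow> 'a \<Rightarrow> 'b" where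
  "laplacian f x = (\<Sum>i\<in>Basis. partial_deriv i (partial_deriv i f) x)"

text \<open>The space of smooth functions on the closure of \<open>\<Omega>\<close>: restrictions to the closure of smooth
  functions on the whole space. Values outside the closure are irrelevant.\<close>

definition smooth_on_closure ::
    "'a::euclidean_space set \<Rightarrow> ('a \<Rightarrow> 'b::real_normed_vector) \<Rightarrow> bool" where
  "smooth_on_closure \<Omega> q \<longleftrightarrow> (\<exists>Q. smooth_on UNIV Q \<and> (\<forall>x\<in>closure \<Omega>. Q x = q x))"


subsection \<open>Bounded domains with smooth boundary\<close>

text \<open>Near each boundary point, \<open>\<Omega>\<close> is the region above the graph of a smooth function over the
  hyperplane orthogonal to some unit vector \<open>e\<close>. The graph function \<open>\<gamma>\<close> is evaluated only on that
  hyperplane; a smooth function there extends to the whole space, constantly in direction \<open>e\<close>.\<close>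

definition smooth_boundary :: "'a::euclidean_space set \<Rightarrow> bool" where
  "smooth_boundary \<Omega> \<longleftrightarrow>
     (\<forall>p\<in>frontier \<Omega>. \<exists>r>0. \<exists>e. \<exists>\<gamma>::'a \<Rightarrow> real.
        norm e = 1 \<and> smooth_on UNIV \<gamma> \<and>
        \<Omega> \<inter> ball p r = {x \<in> ball p r. e \<bullet> x > \<gamma> (x - (e \<bullet> x) *\<^sub>R e)})"

definition smooth_bounded_domain :: "'a::euclidean_space set \<Rightarrow> bool" where
  "smooth_bounded_domain \<Omega> \<longleftrightarrow>
     open \<Omega> \<and> connected \<Omega> \<and> \<Omega> \<noteq> {} \<and> bounded \<Omega> \<and> smooth_boundary \<Omega>"


subsection \<open>Square integrable functions and Sobolev spaces\<close>

text \<open>Elements of the complex Hilbert space of square integrable functions on \<open>\<Omega>\<close> are given by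
  representatives; equality in that space is equality almost everywhere in \<open>\<Omega>\<close>.\<close>

definition L2 :: "'a::euclidean_space set \<Rightarrow> ('a \<Rightarrow> complex) set" where
  "L2 \<Omega> = {u \<in> borel_measurable (lebesgue_on \<Omega>).
             integrable (lebesgue_on \<Omega>) (\<lambda>x. (norm (u x))\<^sup>2)}"

definition L2_norm :: "'a::euclidean_space set \<Rightarrow> ('a \<Rightarrow> complex) \<Rightarrow> real" where
  "L2_norm \<Omega> u = sqrt (LINT x|lebesgue_on \<Omega>. (norm (u x))\<^sup>2)"

definition test_functions :: "'a::euclidean_space set \<Rightarrow> ('a \<Rightarrow> complex) set" where
  "test_functions \<Omega> = {\<phi>. smooth_on UNIV \<phi> \<and>
     compact (closure {x. \<phi> x \<noteq> 0}) \<and> closure {x. \<phi> x \<noteq> 0} \<subseteq> \<Omega>}"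

definition weak_partial ::
    "'a::euclidean_space set \<Rightarrow> 'a \<Rightarrow> ('a \<Rightarrow> complex) \<Rightarrow> ('a \<Rightarrow> complex) \<Rightarrow> bool" where
  "weak_partial \<Omega> i u g \<longleftrightarrow> u \<in> L2 \<Omega> \<and> g \<in> L2 \<Omega> \<and>
     (\<forall>\<phi>\<in>test_functions \<Omega>.
        (LINT x|lebesgue_on \<Omega>. u x * partial_deriv i \<phi> x) =
        - (LINT x|lebesgue_on \<Omega>. g x * \<phi> x))"

definition weak_laplacian ::
    "'a::euclidean_space set \<Rightarrow> ('a \<Rightarrow> complex) \<Rightarrow> ('a \<Rightarrow> complex) \<Rightarrow> bool" where
  "weak_laplacian \<Omega> u g \<longleftrightarrow> u \<in> L2 \<Omega> \<and> g \<in> L2 \<Omega> \<and>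
     (\<forall>\<phi>\<in>test_functions \<Omega>.
        (LINT x|lebesgue_on \<Omega>. u x * laplacian \<phi> x) = (LINT x|lebesgue_on \<Omega>. g x * \<phi> x))"

text \<open>The closure of the test functions in the first-order Sobolev norm; \<open>G i\<close> is the weak
  derivative of \<open>u\<close> in direction \<open>i\<close>.\<close>

definition H10 :: "'a::euclidean_space set \<Rightarrow> ('a \<Rightarrow> complex) set" where
  "H10 \<Omega> = {u \<in> L2 \<Omega>. \<exists>G. (\<forall>i\<in>Basis. weak_partial \<Omega> i u (G i)) \<and>
     (\<exists>\<phi>::nat \<Rightarrow> 'a \<Rightarrow> complex. (\<forall>k. \<phi> k \<in> test_functions \<Omega>) \<and>
        (\<lambda>k. L2_norm \<Omega> (\<lambda>x. \<phi> k x - u x)) \<longlonglongrightarrow> 0 \<and>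
        (\<forall>i\<in>Basis. (\<lambda>k. L2_norm \<Omega> (\<lambda>x. partial_deriv i (\<phi> k) x - G i x)) \<longlonglongrightarrow> 0))}"


subsection \<open>The Dirichlet realization and its inverse\<close>

text \<open>Graph of the Dirichlet realization of \<open>-\<Delta> + q\<close> (with \<open>q\<close> bounded on \<open>\<Omega>\<close>). Its domain consists of
  the \<open>u\<close> in \<open>H10 \<Omega>\<close> whose distributional Laplacian is square integrable.\<close>

definition dirichlet_realization ::
    "'a::euclidean_space set \<Rightarrow> ('a \<Rightarrow> real) \<Rightarrow> ('a \<Rightarrow> complex) \<Rightarrow> ('a \<Rightarrow> complex) \<Rightarrow> bool" where
  "dirichlet_realization \<Omega> q u f \<longleftrightarrow> u \<in> H10 \<Omega> \<and> f \<in> L2 \<Omega> \<and>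
     (\<exists>g. weak_laplacian \<Omega> u g \<and>
        (AE x in lebesgue_on \<Omega>. f x = - g x + complex_of_real (q x) * u x))"

text \<open>For \<open>q \<ge> 0\<close> the realization is a bijection from its domain onto the square integrable functions,
  up to equality almost everywhere, so the choice below only picks a representative.\<close>

definition dirichlet_inverse ::
    "'a::euclidean_space set \<Rightarrow> ('a \<Rightarrow> real) \<Rightarrow> ('a \<Rightarrow> complex) \<Rightarrow> ('a \<Rightarrow> complex)" where
  "dirichlet_inverse \<Omega> q f = (SOME u. dirichlet_realization \<Omega> q u f)"

end

theory Submission
  imports Defs
begin

text \<open>Write \<open>G\<^sub>q\<close> for the inverse of the Dirichlet realization, let \<open>\<phi>\<close> be a test function and put
  \<open>f = -\<Delta>\<phi> + q\<^sub>1\<phi>\<close>, so that \<open>G\<^sub>q\<^sub>1 f = \<phi>\<close>. With \<open>u\<^sub>2 = G\<^sub>q\<^sub>2 f\<close>, applying \<open>-\<Delta>\<close> to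
  \<open>G\<^sub>q f = \<tau>\<phi> + (1 - \<tau>)u\<^sub>2\<close> gives \<open>a\<phi> + b u\<^sub>2 = 0\<close> with \<open>a = \<tau>(q - q\<^sub>1)\<close> and \<open>b = (1 - \<tau>)(q - q\<^sub>2)\<close>.
  If \<open>b \<noteq> 0\<close> at a point \<open>y\<close>, then \<open>u\<^sub>2 = c\<phi>\<close> near \<open>y\<close> with \<open>c = -a/b\<close>, and the weak form of
  \<open>(-\<Delta> + q\<^sub>2)u\<^sub>2 = f\<close>, tested with \<open>\<psi>\<close> supported near \<open>y\<close>, reads
  \<open>\<integral> \<phi> ((c - 1)\<Delta>\<psi> - (q\<^sub>2 c - q\<^sub>1)\<psi>) = 0\<close>. Letting \<open>\<phi>\<close> concentrate at \<open>y\<close>, the bracket vanishes at \<open>y\<close>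
  for every \<open>\<psi>\<close>. A \<open>\<psi>\<close> with \<open>\<psi>(y) = 0 \<noteq> \<Delta>\<psi>(y)\<close> yields \<open>c(y) = 1\<close>, and one with \<open>\<psi>(y) \<noteq> 0\<close> yields
  \<open>q\<^sub>1(y) = q\<^sub>2(y)\<close>; together these give \<open>b(y) = 0\<close>, a contradiction. Hence \<open>q = q\<^sub>2\<close>, and
  \<open>q = q\<^sub>1\<close> by symmetry.\<close>

subsection \<open>Calculus of smooth functions\<close>

lemma partial_deriv_has_derivative:
  "(f has_derivative D) (at x) \<Longrightarrow> partial_deriv i f x = D i"
  unfolding partial_deriv_def by (metis frechet_derivative_at)

lemma Ck_on_Suc_imp: "Ck_on (Suc k) UNIV f \<Longrightarrow> Ck_on k UNIV f"
proof (induction k arbitrary: f)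
  case 0
  then show ?case by (simp add: differentiable_imp_continuous_on)
qed auto

lemma smooth_on_differentiable:
  assumes "smooth_on UNIV f"
  shows "f differentiable (at x)"
  using assms[unfolded smooth_on_def, rule_format, of "Suc 0"]
  by (simp add: differentiable_on_def)

lemma smooth_on_has_derivative:
  "smooth_on UNIV f \<Longrightarrow> (f has_derivative frechet_derivative f (at x)) (at x)"
  using smooth_on_differentiable frechet_derivative_works by blast

lemma smooth_on_continuous: "smooth_on UNIV f \<Longrightarrow> continuous_on S f"
  unfolding smooth_on_def by (metis Ck_on.simps(1) continuous_on_subset subset_UNIV)

lemma smooth_on_partial_deriv:
  "smooth_on UNIV f \<Longrightarrow> i \<in> Basis \<Longrightarrow> smooth_on UNIV (partial_deriv i f)"
  unfolding smooth_on_def by (metis Ck_on.simps(2))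

lemma partial_deriv_const [simp]: "partial_deriv i (\<lambda>x. c) = (\<lambda>x. 0)"
  by (rule ext) (simp add: partial_deriv_def)

lemma smooth_on_const [simp]: "smooth_on UNIV (\<lambda>x::'a::euclidean_space. c)"
proof -
  have "Ck_on k UNIV (\<lambda>x::'a. c)" for k and c :: 'b
    by (induction k arbitrary: c) auto
  then show ?thesis by (simp add: smooth_on_def)
qed

text \<open>The partial derivatives give order \<open>Suc k\<close>. Dropping from there to
  \<open>k\<close> also covers \<open>k = 0\<close>, where \<open>Ck_on\<close> is mere continuity
  and follows from differentiability.\<close>

lemma smooth_on_partial_derivI:
  assumes "\<And>x. f differentiable (at x)" "\<And>i. i \<in> Basis \<Longrightarrow> smooth_on UNIV (partial_deriv i f)"
  shows "smooth_on UNIV f"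
  unfolding smooth_on_def
proof
  fix k
  have "Ck_on (Suc k) UNIV f"
    using assms by (auto simp: smooth_on_def differentiable_on_def)
  then show "Ck_on k UNIV f" by (rule Ck_on_Suc_imp)
qed

lemma (in bounded_linear) partial_deriv_compose:
  assumes "smooth_on UNIV g"
  shows "partial_deriv i (\<lambda>x. f (g x)) = (\<lambda>x. f (partial_deriv i g x))"
proof
  fix x
  show "partial_deriv i (\<lambda>x. f (g x)) x = f (partial_deriv i g x)"
    using partial_deriv_has_derivative[OF has_derivative[OF smooth_on_has_derivative[OF assms]]]
    by (simp add: partial_deriv_def)
qed

text \<open>A bounded linear map commutes with partial derivatives, so the induction hypothesis
  applies to the partials of \<open>g\<close>. The instances used are conjugation and the embedding
  of the reals into the complex numbers.\<close>

lemma (in bounded_linear) smooth_on_compose: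
  fixes g :: "'c::euclidean_space \<Rightarrow> 'a"
  assumes "smooth_on UNIV g"
  shows "smooth_on UNIV (\<lambda>x. f (g x))"
proof -
  have "Ck_on k UNIV (\<lambda>x. f (g x))" if "smooth_on UNIV g" for k and g :: "'c \<Rightarrow> 'a"
    using that
  proof (induction k arbitrary: g)
    case 0
    then show ?case by (simp add: smooth_on_continuous continuous_on)
  next
    case (Suc k)
    have "(\<lambda>x. f (g x)) differentiable_on UNIV"
      using has_derivative[OF smooth_on_has_derivative[OF Suc.prems]]
      by (auto simp: differentiable_on_def differentiable_def)
    then show ?case
      using Suc by (simp add: partial_deriv_compose smooth_on_partial_deriv)
  qed
  then show ?thesis using assms by (simp add: smooth_on_def)
qed

lemma partial_deriv_add:
  assumes "smooth_on UNIV f" "smooth_on UNIV g"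
  shows "partial_deriv i (\<lambda>x. f x + g x) = (\<lambda>x. partial_deriv i f x + partial_deriv i g x)"
proof
  fix x
  show "partial_deriv i (\<lambda>x. f x + g x) x = partial_deriv i f x + partial_deriv i g x"
    using partial_deriv_has_derivative[OF has_derivative_add[OF
        smooth_on_has_derivative[OF assms(1)] smooth_on_has_derivative[OF assms(2)]]]
    by (simp add: partial_deriv_def)
qed

text \<open>Stated order by order, because inductions over the product and chain rules know their
  summands only up to the current order.\<close>

lemma Ck_on_add:
  assumes "Ck_on k UNIV f" "Ck_on k UNIV g"
  shows "Ck_on k UNIV (\<lambda>x. f x + g x)"
  using assms
proof (induction k arbitrary: f g)
  case 0
  then show ?case by (simp add: continuous_on_add)
next
  case (Suc k)
  have d: "(f has_derivative frechet_derivative f (at x)) (at x)"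
    "(g has_derivative frechet_derivative g (at x)) (at x)" for x
    using Suc.prems by (auto simp: differentiable_on_def simp flip: frechet_derivative_works)
  have "partial_deriv i (\<lambda>x. f x + g x) = (\<lambda>x. partial_deriv i f x + partial_deriv i g x)" for i
    using partial_deriv_has_derivative[OF has_derivative_add[OF d]]
    by (auto simp: partial_deriv_def)
  then show ?case using Suc by (auto intro: differentiable_on_add)
qed

lemma smooth_on_add:
  "smooth_on UNIV f \<Longrightarrow> smooth_on UNIV g \<Longrightarrow> smooth_on UNIV (\<lambda>x. f x + g x)"
  by (simp add: smooth_on_def Ck_on_add)

lemma (in bounded_bilinear) partial_deriv_prod:
  assumes "f differentiable (at x)" "g differentiable (at x)"
  shows "partial_deriv i (\<lambda>x. prod (f x) (g x)) x =
    prod (f x) (partial_deriv i g x) + prod (partial_deriv i f x) (g x)"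
  using partial_deriv_has_derivative[OF FDERIV[OF assms[unfolded frechet_derivative_works]]]
  by (simp add: partial_deriv_def)

text \<open>Both factors stay smooth throughout the induction and only the order of the product
  grows; hence the induction hypothesis covers each of the two Leibniz terms.\<close>

lemma (in bounded_bilinear) smooth_on_prod:
  fixes f :: "'d::euclidean_space \<Rightarrow> 'a"
  assumes "smooth_on UNIV f" "smooth_on UNIV g"
  shows "smooth_on UNIV (\<lambda>x. prod (f x) (g x))"
proof -
  have "Ck_on k UNIV (\<lambda>x. prod (f x) (g x))" if "smooth_on UNIV f" "smooth_on UNIV g" for k and f :: "'d \<Rightarrow> 'a" and g
    using that
  proof (induction k arbitrary: f g)
    case 0
    then show ?case by (simp add: smooth_on_continuous continuous_on)
  next
    case (Suc k)
    note d = smooth_on_has_derivative[OF Suc.prems(1)] smooth_on_has_derivative[OF Suc.prems(2)]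
    have "(\<lambda>x. prod (f x) (g x)) differentiable_on UNIV"
      using FDERIV[OF d] by (auto simp: differentiable_on_def differentiable_def)
    moreover have "partial_deriv i (\<lambda>x. prod (f x) (g x)) =
        (\<lambda>x. prod (f x) (partial_deriv i g x) + prod (partial_deriv i f x) (g x))" for i
      using partial_deriv_prod[OF smooth_on_differentiable[OF Suc.prems(1)]
          smooth_on_differentiable[OF Suc.prems(2)]] by auto
    ultimately show ?case
      using Suc by (auto intro!: Ck_on_add smooth_on_partial_deriv)
  qed
  then show ?thesis using assms by (simp add: smooth_on_def)
qed

lemmas smooth_on_mult = bounded_bilinear.smooth_on_prod[OF bounded_bilinear_mult]
lemmas partial_deriv_mult = bounded_bilinear.partial_deriv_prod[OF bounded_bilinear_mult]

lemma smooth_on_inner_left: "smooth_on UNIV (\<lambda>x. x \<bullet> e)"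
proof (rule smooth_on_partial_derivI)
  have d: "((\<lambda>x. x \<bullet> e) has_derivative (\<lambda>h. h \<bullet> e)) (at x)" for x :: 'a
    by (auto intro!: derivative_eq_intros)
  then show "(\<lambda>x. x \<bullet> e) differentiable (at x)" for x
    unfolding differentiable_def by blast
  have "partial_deriv i (\<lambda>x. x \<bullet> e) = (\<lambda>x. i \<bullet> e)" for i
    using partial_deriv_has_derivative[OF d] by auto
  then show "smooth_on UNIV (partial_deriv i (\<lambda>x. x \<bullet> e))" for i by simp
qed

text \<open>The outer function is given together with the sequence \<open>h\<close> of its
  successive derivatives, which replaces a separate notion of smoothness in one variable.\<close>

lemma smooth_on_compose_real:
  fixes h :: "nat \<Rightarrow> real \<Rightarrow> real" and s :: "'a::euclidean_space \<Rightarrow> real"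
  assumes h: "\<And>n t. (h n has_real_derivative h (Suc n) t) (at t)" and s: "smooth_on UNIV s"
  shows "smooth_on UNIV (\<lambda>x. h n (s x))"
proof -
  have d: "((\<lambda>x. h n (s x)) has_derivative (\<lambda>v. h (Suc n) (s x) * frechet_derivative s (at x) v)) (at x)"
    for n x
    using has_derivative_compose[OF smooth_on_has_derivative[OF s],
        OF h[unfolded has_field_derivative_def]] .
  have pd: "partial_deriv i (\<lambda>x. h n (s x)) = (\<lambda>x. h (Suc n) (s x) * partial_deriv i s x)" for i n
    using partial_deriv_has_derivative[OF d] by (auto simp: partial_deriv_def)
  have diff: "(\<lambda>x. h n (s x)) differentiable (at x)" for n x
    using d unfolding differentiable_def by blast
  \<comment> \<open>The extra smooth factor \<open>g\<close> and the arbitrary index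
    \<open>n\<close> make the claim stable under differentiation: the chain rule raises
    \<open>n\<close> by one and multiplies \<open>g\<close> by a partial derivative of
    \<open>s\<close>.\<close>
  have "Ck_on k UNIV (\<lambda>x. h n (s x) * g x)" if "smooth_on UNIV g" for k n g
    using that
  proof (induction k arbitrary: n g)
    case 0
    have "continuous_on UNIV (\<lambda>x. h n (s x))"
      using diff by (meson continuous_at_imp_continuous_on differentiable_imp_continuous_within)
    with 0 show ?case by (auto intro: continuous_on_mult smooth_on_continuous)
  next
    case (Suc k)
    have "partial_deriv i (\<lambda>x. h n (s x) * g x) =
       (\<lambda>x. h n (s x) * partial_deriv i g x + h (Suc n) (s x) * (partial_deriv i s x * g x))" for i
      using partial_deriv_mult[OF diff smooth_on_differentiable[OF Suc.prems]]
      by (auto simp: pd)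
    moreover have "Ck_on k UNIV (\<lambda>x. h n (s x) * partial_deriv i g x + h (Suc n) (s x) * (partial_deriv i s x * g x))"
      if "i \<in> Basis" for i
      by (intro Ck_on_add Suc.IH smooth_on_mult smooth_on_partial_deriv s Suc.prems that)
    moreover have "(\<lambda>x. h n (s x) * g x) differentiable_on UNIV"
      by (simp add: differentiable_on_def diff smooth_on_differentiable[OF Suc.prems] differentiable_mult)
    ultimately show ?case by simp
  qed
  from this[OF smooth_on_const, of _ n 1] show ?thesis by (simp add: smooth_on_def)
qed

lemma smooth_on_sum:
  assumes "\<And>i. i \<in> I \<Longrightarrow> smooth_on UNIV (f i)"
  shows "smooth_on UNIV (\<lambda>x. \<Sum>i\<in>I. f i x)"
  using assms by (induction I rule: infinite_finite_induct) (auto intro: smooth_on_add)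

lemma laplacian_smooth: "smooth_on UNIV f \<Longrightarrow> smooth_on UNIV (laplacian f)"
  unfolding laplacian_def[abs_def] by (intro smooth_on_sum smooth_on_partial_deriv)

lemma (in bounded_linear) laplacian_compose:
  assumes "smooth_on UNIV g"
  shows "laplacian (\<lambda>x. f (g x)) = (\<lambda>x. f (laplacian g x))"
  unfolding laplacian_def[abs_def] 
  by (auto simp: partial_deriv_compose assms smooth_on_partial_deriv sum)

subsection \<open>Smooth bumps\<close>

text \<open>The polynomial factor makes this family closed under differentiation;
  \<open>flat 1\<close> is the standard smooth function that vanishes to infinite order at
  0.\<close>

definition flat :: "real poly \<Rightarrow> real \<Rightarrow> real" where
  "flat p t = (if t > 0 then poly p (1 / t) * exp (- 1 / t) else 0)"

text \<open>Differentiating p(1/t) exp(-1/t) produces the factor 1/t squared times (p - p')(1/t);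
  the polynomial \<open>[:0, 0, 1:]\<close> is the square of the variable.\<close>

definition flat_deriv :: "real poly \<Rightarrow> real poly" where
  "flat_deriv p = [:0, 0, 1:] * (p - pderiv p)"

lemma poly_exp_tendsto_0: "((\<lambda>y. poly p y * exp (- y)) \<longlongrightarrow> 0) at_top" for p :: "real poly"
proof -
  have "((\<lambda>y. \<Sum>i\<le>degree p. coeff p i * (y ^ i / exp y)) \<longlongrightarrow> (\<Sum>i\<le>degree p. coeff p i * 0)) at_top"
    by (intro tendsto_sum tendsto_mult_left tendsto_power_div_exp_0)
  then show ?thesis
    by (simp add: poly_altdef exp_minus sum_distrib_left sum_distrib_right divide_inverse mult_ac)
qed

lemma flat_has_derivative: "(flat p has_real_derivative flat (flat_deriv p) t) (at t)"
proof -
  consider "t > 0" | "t < 0" | "t = 0" by linarith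
  then show ?thesis
  proof cases
    case 1
    have "((\<lambda>t. poly p (1 / t)) has_real_derivative poly (pderiv p) (1 / t) * (- 1 / t\<^sup>2)) (at t)"
      using 1 by (intro DERIV_chain2[OF poly_DERIV])
        (auto intro!: derivative_eq_intros simp: power2_eq_square)
    then have "((\<lambda>t. poly p (1 / t) * exp (- 1 / t)) has_real_derivative flat (flat_deriv p) t) (at t)"
      using 1 by (auto intro!: derivative_eq_intros simp: flat_def flat_deriv_def field_simps power2_eq_square)
    then show ?thesis
      by (rule has_field_derivative_transform_within_open[where S = "{0<..}"]) (use 1 in \<open>auto simp: flat_def\<close>)
  next
    case 2
    have "((\<lambda>t. 0) has_real_derivative flat (flat_deriv p) t) (at t)"
      using 2 by (auto simp: flat_def)
    then show ?thesis
      by (rule has_field_derivative_transform_within_open[where S = "{..<0}"]) (use 2 in \<open>auto simp: flat_def\<close>)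
  next
    case 3
    \<comment> \<open>On the right of 0 the difference quotient is again of the form polynomial
      times exponential in 1/h: dividing by h multiplies \<open>p\<close> by the variable. On the
      left it is identically 0.\<close>
    have "((\<lambda>h. poly ([:0, 1:] * p) (inverse h) * exp (- inverse h)) \<longlongrightarrow> 0) (at_right 0)"
      by (rule filterlim_compose[OF poly_exp_tendsto_0 filterlim_inverse_at_top_right])
    then have "((\<lambda>h. flat p h / h) \<longlongrightarrow> 0) (at_right 0)"
      by (rule Lim_transform_eventually)
        (auto simp: eventually_at_filter flat_def field_simps)
    moreover have "((\<lambda>h. flat p h / h) \<longlongrightarrow> 0) (at_left 0)"
      by (rule Lim_transform_eventually[OF tendsto_const])
        (auto simp: eventually_at_filter flat_def)
    ultimately show ?thesis
      using 3 by (simp add: DERIV_def filterlim_split_at flat_def)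
  qed
qed


lemma smooth_on_flat: "smooth_on UNIV s \<Longrightarrow> smooth_on UNIV (\<lambda>x. flat p (s x))"
  using smooth_on_compose_real[where h = "\<lambda>n. flat ((flat_deriv ^^ n) p)" and n = 0 and s = s]
  by (simp add: flat_has_derivative)

text \<open>The squared distance is used since it is a polynomial in the coordinates, hence smooth
  at the centre \<open>y\<close> as well.\<close>

definition bump :: "'a::euclidean_space \<Rightarrow> real \<Rightarrow> 'a \<Rightarrow> real" where
  "bump y d x = flat 1 (d\<^sup>2 - (x - y) \<bullet> (x - y))"

lemma smooth_on_bump: "smooth_on UNIV (bump y d)"
  unfolding bump_def[abs_def]
proof (rule smooth_on_flat)
  have *: "(x - y) \<bullet> (x - y) = (\<Sum>e\<in>Basis. (x \<bullet> e + - (y \<bullet> e)) * (x \<bullet> e + - (y \<bullet> e)))" for x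
    by (subst euclidean_inner) (simp add: inner_diff_left)
  have "smooth_on UNIV (\<lambda>x. d\<^sup>2 + (- 1) * ((x - y) \<bullet> (x - y)))"
    unfolding * by (intro smooth_on_add smooth_on_const smooth_on_mult smooth_on_sum smooth_on_inner_left)
  then show "smooth_on UNIV (\<lambda>x. d\<^sup>2 - (x - y) \<bullet> (x - y))" by simp
qed

lemma bump_pos_iff: "d > 0 \<Longrightarrow> bump y d x > 0 \<longleftrightarrow> x \<in> ball y d"
  \<comment> \<open>A multiple of a basis vector serves as a vector of norm \<open>d\<close>,
    turning the comparison of inner products into one of norms.\<close>
  using norm_lt[of "x - y" "d *\<^sub>R (SOME b. b \<in> Basis)"]
  by (simp add: bump_def flat_def dist_norm norm_minus_commute[of y x] power2_eq_square
      flip: power2_norm_eq_inner)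

lemma bump_nonneg: "bump y d x \<ge> 0"
  by (simp add: bump_def flat_def)

text \<open>A nonnegative function that vanishes at the centre while its Laplacian does not.
  Evaluating an identity between the function and its Laplacian at \<open>y\<close> therefore
  isolates the coefficient of the Laplacian.\<close>

definition dented_bump :: "'a::euclidean_space \<Rightarrow> 'a \<Rightarrow> real \<Rightarrow> 'a \<Rightarrow> real" where
  "dented_bump e y d x = ((x - y) \<bullet> e)\<^sup>2 * bump y d x"

lemma dented_bump_nonneg: "dented_bump e y d x \<ge> 0"
  by (simp add: dented_bump_def bump_nonneg)

lemma dented_bump_center [simp]: "dented_bump e y d y = 0"
  by (simp add: dented_bump_def)

lemma dented_bump_eq:
  "dented_bump e y d = (\<lambda>x. (x \<bullet> e + - (y \<bullet> e)) * ((x \<bullet> e + - (y \<bullet> e)) * bump y d x))"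
  by (rule ext) (simp add: dented_bump_def inner_diff_left power2_eq_square algebra_simps)

lemma smooth_on_dented_bump: "smooth_on UNIV (dented_bump e y d)"
  unfolding dented_bump_eq
  by (intro smooth_on_add smooth_on_const smooth_on_mult smooth_on_inner_left smooth_on_bump)

text \<open>With \<open>s\<close> the coordinate vanishing at \<open>y\<close>, the function is s
  times (s times the bump). A term of the second derivative survives at \<open>y\<close> only if
  both factors \<open>s\<close> are differentiated, which happens twice and only in direction
  \<open>e\<close>.\<close>

lemma laplacian_dented_bump_center:
  assumes "e \<in> Basis"
  shows "laplacian (dented_bump e y d) y = 2 * bump y d y"
proof -
  define s where "s x = x \<bullet> e + - (y \<bullet> e)" for x
  define g where "g x = s x * bump y d x" for x
  have s: "smooth_on UNIV s"
    unfolding s_def[abs_def] by (intro smooth_on_add smooth_on_const smooth_on_inner_left)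
  then have g: "smooth_on UNIV g"
    unfolding g_def[abs_def] by (intro smooth_on_mult smooth_on_bump)
  have ds: "partial_deriv i s = (\<lambda>x. i \<bullet> e)" for i
  proof
    fix x
    have "(s has_derivative (\<lambda>h. h \<bullet> e)) (at x)"
      unfolding s_def[abs_def] by (auto intro!: derivative_eq_intros)
    then show "partial_deriv i s x = i \<bullet> e" by (rule partial_deriv_has_derivative)
  qed
  note diff = smooth_on_differentiable
  have f: "dented_bump e y d = (\<lambda>x. s x * g x)"
    by (simp add: dented_bump_eq s_def g_def)
  have s0: "s y = 0" by (simp add: s_def)
  have dg: "partial_deriv i g y = (i \<bullet> e) * bump y d y" for i
    unfolding g_def[abs_def]
    by (subst partial_deriv_mult[OF diff[OF s] diff[OF smooth_on_bump]]) (simp add: ds s0)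
  have df: "partial_deriv i (dented_bump e y d) = (\<lambda>x. s x * partial_deriv i g x + (i \<bullet> e) * g x)" for i
    unfolding f using partial_deriv_mult[OF diff[OF s] diff[OF g]] by (auto simp: ds)
  have "partial_deriv i (partial_deriv i (dented_bump e y d)) y = 2 * (i \<bullet> e)\<^sup>2 * bump y d y"
    if "i \<in> Basis" for i
  proof -
    have i: "smooth_on UNIV (partial_deriv i g)" by (rule smooth_on_partial_deriv[OF g that])
    show ?thesis
      unfolding df
      by (simp add: partial_deriv_add smooth_on_mult s g i
          partial_deriv_mult[OF diff[OF s] diff[OF i]]
          partial_deriv_mult[OF diff[OF smooth_on_const] diff[OF g]] ds s0 dg power2_eq_square)
  qed
  then have "laplacian (dented_bump e y d) y = (\<Sum>i\<in>Basis. 2 * (i \<bullet> e)\<^sup>2 * bump y d y)"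
    by (simp add: laplacian_def)
  also have "\<dots> = (\<Sum>i\<in>Basis. if i = e then 2 * bump y d y else 0)"
    using assms by (intro sum.cong) (auto simp: inner_Basis)
  finally show ?thesis using assms by simp
qed

subsection \<open>Test functions\<close>

lemma test_functionsI:
  assumes "smooth_on UNIV \<phi>" "compact K" "K \<subseteq> \<Omega>" "\<And>x. x \<notin> K \<Longrightarrow> \<phi> x = 0"
  shows "\<phi> \<in> test_functions \<Omega>"
proof -
  have sub: "closure {x. \<phi> x \<noteq> 0} \<subseteq> K"
    using assms(2,4) by (intro closure_minimal) (auto simp: compact_imp_closed)
  then have "compact (closure {x. \<phi> x \<noteq> 0})"
    using compact_Int_closed[OF assms(2) closed_closure, of "{x. \<phi> x \<noteq> 0}"]
    by (simp add: Int_absorb1)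
  then show ?thesis using sub assms by (auto simp: test_functions_def)
qed

lemma test_functions_support:
  assumes "\<phi> \<in> test_functions \<Omega>"
  shows "\<exists>K. compact K \<and> K \<subseteq> \<Omega> \<and> (\<forall>x. x \<notin> K \<longrightarrow> \<phi> x = 0)"
  using assms closure_subset[of "{x. \<phi> x \<noteq> 0}"]
  by (intro exI[of _ "closure {x. \<phi> x \<noteq> 0}"]) (auto simp: test_functions_def)

lemma test_functions_smooth: "\<phi> \<in> test_functions \<Omega> \<Longrightarrow> smooth_on UNIV \<phi>"
  by (simp add: test_functions_def)

lemma test_functions_outside: "\<phi> \<in> test_functions \<Omega> \<Longrightarrow> x \<notin> \<Omega> \<Longrightarrow> \<phi> x = 0"
  using closure_subset[of "{x. \<phi> x \<noteq> 0}"] by (auto simp: test_functions_def)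

lemma partial_deriv_outside_compact:
  assumes "compact K" "\<And>x. x \<notin> K \<Longrightarrow> \<phi> x = 0" "x \<notin> K"
  shows "partial_deriv i \<phi> x = 0"
proof -
  have "(\<phi> has_derivative (\<lambda>h. 0)) (at x)"
    by (rule has_derivative_transform_within_open[OF has_derivative_const, of "- K" _ 0])
      (use assms in \<open>auto intro: compact_imp_closed\<close>)
  then show ?thesis by (rule partial_deriv_has_derivative)
qed

lemma test_functions_partial_deriv:
  assumes "\<phi> \<in> test_functions \<Omega>" "i \<in> Basis"
  shows "partial_deriv i \<phi> \<in> test_functions \<Omega>"
proof -
  obtain K where K: "compact K" "K \<subseteq> \<Omega>" "\<And>x. x \<notin> K \<Longrightarrow> \<phi> x = 0"
    using test_functions_support[OF assms(1)] by blast
  show ?thesis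
    by (rule test_functionsI[OF smooth_on_partial_deriv[OF test_functions_smooth[OF assms(1)] assms(2)] K(1,2)
          partial_deriv_outside_compact[OF K(1,3)]])
qed

lemma test_functions_mult:
  assumes "\<phi> \<in> test_functions \<Omega>" "smooth_on UNIV g"
  shows "(\<lambda>x. g x * \<phi> x) \<in> test_functions \<Omega>"
proof -
  obtain K where "compact K" "K \<subseteq> \<Omega>" "\<And>x. x \<notin> K \<Longrightarrow> \<phi> x = 0"
    using test_functions_support[OF assms(1)] by blast
  then show ?thesis
    by (intro test_functionsI[of _ K])
      (auto intro: smooth_on_mult assms(2) test_functions_smooth[OF assms(1)])
qed

lemma test_functions_cnj:
  assumes "\<phi> \<in> test_functions \<Omega>"
  shows "(\<lambda>x. cnj (\<phi> x)) \<in> test_functions \<Omega>"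
proof -
  obtain K where "compact K" "K \<subseteq> \<Omega>" "\<And>x. x \<notin> K \<Longrightarrow> \<phi> x = 0"
    using test_functions_support[OF assms(1)] by blast
  then show ?thesis
    by (intro test_functionsI[of _ K])
      (auto intro: bounded_linear.smooth_on_compose[OF bounded_linear_cnj] test_functions_smooth[OF assms(1)])
qed

lemma test_functions_add:
  assumes "\<phi> \<in> test_functions \<Omega>" "\<psi> \<in> test_functions \<Omega>"
  shows "(\<lambda>x. \<phi> x + \<psi> x) \<in> test_functions \<Omega>"
proof -
  obtain K where K: "compact K" "K \<subseteq> \<Omega>" "\<And>x. x \<notin> K \<Longrightarrow> \<phi> x = 0"
    using test_functions_support[OF assms(1)] by blast
  obtain L where L: "compact L" "L \<subseteq> \<Omega>" "\<And>x. x \<notin> L \<Longrightarrow> \<psi> x = 0"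
    using test_functions_support[OF assms(2)] by blast
  show ?thesis
    by (rule test_functionsI[of _ "K \<union> L"])
      (use K L assms in \<open>auto intro: smooth_on_add compact_Un test_functions_smooth\<close>)
qed

lemma test_functions_zero: "(\<lambda>x. 0) \<in> test_functions \<Omega>"
  by (simp add: test_functions_def)

lemma test_functions_sum:
  "(\<And>i. i \<in> I \<Longrightarrow> f i \<in> test_functions \<Omega>) \<Longrightarrow> (\<lambda>x. \<Sum>i\<in>I. f i x) \<in> test_functions \<Omega>"
  by (induction I rule: infinite_finite_induct) (auto intro: test_functions_add test_functions_zero)

lemma test_functions_laplacian:
  "\<phi> \<in> test_functions \<Omega> \<Longrightarrow> laplacian \<phi> \<in> test_functions \<Omega>"
  unfolding laplacian_def[abs_def] by (intro test_functions_sum test_functions_partial_deriv)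

lemma test_functions_of_real:
  fixes f :: "'a::euclidean_space \<Rightarrow> real"
  assumes "smooth_on UNIV f" "\<And>x. x \<notin> cball y d \<Longrightarrow> f x = 0" "cball y d \<subseteq> \<Omega>"
  shows "(\<lambda>x. complex_of_real (f x)) \<in> test_functions \<Omega>"
  by (rule test_functionsI[of _ "cball y d"])
    (use assms in \<open>auto intro: bounded_linear.smooth_on_compose[OF bounded_linear_of_real]\<close>)

subsection \<open>Integration by parts\<close>

lemma lborel_integral_translation:
  fixes h :: "'a::euclidean_space \<Rightarrow> 'b::{banach, second_countable_topology}"
  assumes "h \<in> borel_measurable borel"
  shows "(LINT x|lborel. h (x + c)) = (LINT x|lborel. h x)"
  using integral_distr[of "(+) c" lborel borel h] assms
  by (simp add: lborel_distr_plus add.commute)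

text \<open>Difference quotients have integral 0 by translation invariance, and dominated
  convergence passes this on to the derivative.\<close>

lemma integral_partial_deriv_eq_0:
  fixes h :: "'a::euclidean_space \<Rightarrow> complex"
  assumes h: "h \<in> test_functions \<Omega>" and i: "i \<in> Basis"
  shows "(LINT x|lborel. partial_deriv i h x) = 0"
proof -
  obtain K where K: "compact K" and h0: "\<And>x. x \<notin> K \<Longrightarrow> h x = 0"
    using test_functions_support[OF h] by blast
  have sm: "smooth_on UNIV h" by (rule test_functions_smooth[OF h])
  have dh0: "partial_deriv i h x = 0" if "x \<notin> K" for x
    by (rule partial_deriv_outside_compact[OF K h0 that])
  have smd: "smooth_on UNIV (partial_deriv i h)" by (rule smooth_on_partial_deriv[OF sm i])
  obtain B where B: "\<And>x. x \<in> K \<Longrightarrow> norm (partial_deriv i h x) \<le> B" "B > 0"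
    using compact_imp_bounded[OF compact_continuous_image[OF smooth_on_continuous[OF smd] K]]
    unfolding bounded_pos by blast
  have B': "norm (partial_deriv i h x) \<le> B" for x
    using B dh0[of x] by (cases "x \<in> K") auto
  obtain R where R: "\<And>x. x \<in> K \<Longrightarrow> norm x \<le> R"
    using compact_imp_bounded[OF K] by (auto simp: bounded_iff)
  have dpath: "((\<lambda>t. h (x + t *\<^sub>R i)) has_derivative (\<lambda>s. s *\<^sub>R partial_deriv i h (x + t *\<^sub>R i))) (at t)"
    for x t
  proof -
    have "((\<lambda>t. x + t *\<^sub>R i) has_derivative (\<lambda>s. s *\<^sub>R i)) (at t)"
      by (auto intro!: derivative_eq_intros)
    from has_derivative_compose[OF this smooth_on_has_derivative[OF sm]]
    show ?thesis
      unfolding partial_deriv_def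
      by (simp add: linear_cmul[OF bounded_linear.linear[OF has_derivative_bounded_linear[OF smooth_on_has_derivative[OF sm]]]])
  qed
  have onorm: "onorm (\<lambda>s. s *\<^sub>R partial_deriv i h x) \<le> B" for x
  proof (rule onorm_bound)
    show "norm (s *\<^sub>R partial_deriv i h x) \<le> B * norm s" for s
      using mult_left_mono[OF B'[of x], of "\<bar>s\<bar>"] by (simp add: mult.commute)
  qed (use B in simp)
  \<comment> \<open>The step length 1/(n+1) is at most 1, so all quotients vanish outside the ball
    of radius \<open>R + 1\<close>; inside, the mean value inequality along direction
    \<open>i\<close> bounds them by \<open>B\<close>.\<close>
  define s where "s n x = (real (Suc n)) *\<^sub>R (h (x + (1 / real (Suc n)) *\<^sub>R i) - h x)" for n x
  have hm: "h \<in> borel_measurable borel"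
    by (intro borel_measurable_continuous_onI smooth_on_continuous[OF sm])
  have dhm: "partial_deriv i h \<in> borel_measurable borel"
    by (intro borel_measurable_continuous_onI smooth_on_continuous[OF smd])
  have hm': "(\<lambda>x. h (x + c)) \<in> borel_measurable borel" for c
    by (intro borel_measurable_continuous_onI continuous_on_compose2[OF smooth_on_continuous[OF sm, of UNIV]] continuous_intros) auto
  have s_meas: "s n \<in> borel_measurable lborel" for n
    unfolding s_def[abs_def] using hm hm' by simp
  have hint: "integrable lborel h"
  proof -
    have "(\<lambda>x. indicator K x *\<^sub>R h x) = h" using h0 by (auto simp: indicator_def)
    then show ?thesis
      using borel_integrable_compact[OF K smooth_on_continuous[OF sm]] by (simp add: set_integrable_def)
  qed
  have hint': "integrable lborel (\<lambda>x. h (x + c))" for c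
    using integrable_distr_eq[of "(+) c" lborel borel h] hm hint
    by (simp add: lborel_distr_plus add.commute)
  have s0: "(LINT x|lborel. s n x) = 0" for n
    unfolding s_def using hint hint' lborel_integral_translation[OF hm] by simp
  have bound: "norm (s n x) \<le> B * indicator (cball 0 (R + 1)) x" for n x
  proof (cases "x \<in> cball 0 (R + 1)")
    case True
    have "norm (h (x + (1 / real (Suc n)) *\<^sub>R i) - h (x + 0 *\<^sub>R i)) \<le> B * norm (1 / real (Suc n) - 0)"
      by (rule differentiable_bound[where S = UNIV and f' = "\<lambda>t s. s *\<^sub>R partial_deriv i h (x + t *\<^sub>R i)"])
        (auto intro: dpath onorm)
    then have "real (Suc n) * norm (h (x + (1 / real (Suc n)) *\<^sub>R i) - h x) \<le> B"
      by (simp add: field_simps)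
    then show ?thesis using True by (simp add: s_def)
  next
    case False
    have "norm x \<le> norm (x + (1 / real (Suc n)) *\<^sub>R i) + norm ((1 / real (Suc n)) *\<^sub>R i)"
      by (metis add_diff_cancel_right' norm_triangle_ineq4)
    moreover have "norm ((1 / real (Suc n)) *\<^sub>R i) \<le> 1" using i by simp
    moreover have "norm x > R + 1" using False by simp
    ultimately have "norm (x + (1 / real (Suc n)) *\<^sub>R i) > R" "norm x > R" by linarith+
    then have "h (x + (1 / real (Suc n)) *\<^sub>R i) = 0" "h x = 0"
      using R h0 by (meson not_le)+
    then show ?thesis using False by (simp add: s_def)
  qed
  have lim: "(\<lambda>n. s n x) \<longlonglongrightarrow> partial_deriv i h x" for x
  proof -
    let ?D = "partial_deriv i h x"
    have "((\<lambda>t. norm (h (x + t *\<^sub>R i) - h x - t *\<^sub>R ?D) / norm t) \<longlongrightarrow> 0) (at 0)"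
      using dpath[of x 0] by (simp add: has_derivative_at)
    moreover have "norm (h (x + t *\<^sub>R i) - h x - t *\<^sub>R ?D) / norm t =
        norm ((h (x + t *\<^sub>R i) - h x) /\<^sub>R t - ?D)" if "t \<noteq> 0" for t
    proof -
      have "(h (x + t *\<^sub>R i) - h x) /\<^sub>R t - ?D = (h (x + t *\<^sub>R i) - h x - t *\<^sub>R ?D) /\<^sub>R t"
        using that by (simp add: scaleR_diff_right)
      then show ?thesis by (simp add: divide_inverse mult.commute)
    qed
    ultimately have "((\<lambda>t. norm ((h (x + t *\<^sub>R i) - h x) /\<^sub>R t - ?D)) \<longlongrightarrow> 0) (at 0)"
      using Lim_cong_within[OF refl refl refl] by (metis (no_types, lifting))
    then have lim0: "((\<lambda>t. (h (x + t *\<^sub>R i) - h x) /\<^sub>R t) \<longlongrightarrow> ?D) (at 0)"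
      using LIM_zero_iff tendsto_norm_zero_iff by blast
    have "filterlim (\<lambda>n. 1 / real (Suc n)) (at 0) sequentially"
      by (intro filterlim_atI) (auto intro: lim_1_over_n LIMSEQ_Suc simp del: of_nat_Suc)
    from filterlim_compose[OF lim0 this] show ?thesis
      unfolding s_def by (simp del: of_nat_Suc)
  qed
  have "(\<lambda>n. LINT x|lborel. s n x) \<longlonglongrightarrow> (LINT x|lborel. partial_deriv i h x)"
  proof (rule integral_dominated_convergence[where w = "\<lambda>x. B * indicator (cball 0 (R + 1)) x"])
    show "integrable lborel (\<lambda>x::'a. B * indicator (cball 0 (R + 1)) x :: real)"
      using emeasure_bounded_finite[OF bounded_cball, of "0::'a" "R + 1"]
      by (intro integrable_mult_right integrable_real_indicator) (auto simp: infinity_ennreal_def)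
  qed (use dhm s_meas lim bound in auto)
  then show ?thesis by (simp add: s0 LIMSEQ_const_iff)
qed

subsection \<open>Square integrable functions on a bounded open set\<close>

locale bounded_open_set =
  fixes \<Omega> :: "'a::euclidean_space set"
  assumes open_set: "open \<Omega>" and bounded_set: "bounded \<Omega>"
begin

abbreviation M :: "'a measure" where "M \<equiv> lebesgue_on \<Omega>"

lemma sets_Omega: "\<Omega> \<inter> space lebesgue \<in> sets lebesgue"
  using open_set by (simp add: lmeasurable_open bounded_set fmeasurableD)

lemma finite_measure_M: "finite_measure M"
  by (intro finite_measure_lebesgue_on lmeasurable_open open_set bounded_set)

lemma borel_measurable_M: "f \<in> borel_measurable borel \<Longrightarrow> f \<in> borel_measurable M"
  by (intro measurable_restrict_space1 measurable_completion) simp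

lemma continuous_measurable:
  fixes F :: "'a \<Rightarrow> 'b::real_normed_vector"
  shows "continuous_on UNIV F \<Longrightarrow> F \<in> borel_measurable M"
  by (intro borel_measurable_M borel_measurable_continuous_onI)

lemma AE_M_I: "(\<And>x. x \<in> \<Omega> \<Longrightarrow> P x) \<Longrightarrow> AE x in M. P x"
  by (rule AE_I2) simp

text \<open>Continuity reaches the closure of \<Omega>, which is compact.\<close>

lemma continuous_bounded:
  fixes F :: "'a \<Rightarrow> 'b::real_normed_vector"
  assumes "continuous_on UNIV F"
  shows "\<exists>B>0. \<forall>x\<in>\<Omega>. norm (F x) \<le> B"
proof -
  have "bounded (F ` closure \<Omega>)"
    using assms bounded_set
    by (intro compact_imp_bounded compact_continuous_image) (auto intro: continuous_on_subset)
  then show ?thesis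
    using closure_subset[of \<Omega>] unfolding bounded_pos by blast
qed

lemma continuous_integrable:
  fixes F :: "'a \<Rightarrow> 'b::{banach, second_countable_topology}"
  assumes "continuous_on UNIV F"
  shows "integrable M F"
proof -
  obtain B where "B > 0" "\<And>x. x \<in> \<Omega> \<Longrightarrow> norm (F x) \<le> B"
    using continuous_bounded[OF assms] by blast
  then show ?thesis
    by (intro finite_measure.integrable_const_bound[OF finite_measure_M, of _ B] AE_M_I
        continuous_measurable assms)
qed

lemma continuous_L2: "continuous_on UNIV F \<Longrightarrow> F \<in> L2 \<Omega>"
  by (auto simp: L2_def intro!: continuous_measurable continuous_integrable continuous_intros)

lemma test_functions_continuous: "\<phi> \<in> test_functions \<Omega> \<Longrightarrow> continuous_on S \<phi>"
  by (intro smooth_on_continuous test_functions_smooth)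

lemma test_functions_L2: "\<phi> \<in> test_functions \<Omega> \<Longrightarrow> \<phi> \<in> L2 \<Omega>"
  by (intro continuous_L2 test_functions_continuous)

lemma L2_measurable: "u \<in> L2 \<Omega> \<Longrightarrow> u \<in> borel_measurable M"
  by (simp add: L2_def)

lemma L2_integrable: "u \<in> L2 \<Omega> \<Longrightarrow> integrable M (\<lambda>x. (norm (u x))\<^sup>2)"
  by (simp add: L2_def)

lemma L2_dominated:
  assumes "v \<in> borel_measurable M" "integrable M w" "AE x in M. (norm (v x))\<^sup>2 \<le> w x"
  shows "v \<in> L2 \<Omega>"
proof -
  have "integrable M (\<lambda>x. (norm (v x))\<^sup>2)"
    by (rule Bochner_Integration.integrable_bound[OF assms(2)]) (use assms in auto)
  then show ?thesis using assms by (simp add: L2_def)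
qed

lemma L2_mult_bounded:
  assumes "u \<in> L2 \<Omega>" "F \<in> borel_measurable M" "AE x in M. norm (F x) \<le> B"
  shows "(\<lambda>x. F x * u x) \<in> L2 \<Omega>"
proof (rule L2_dominated)
  show "AE x in M. (norm (F x * u x))\<^sup>2 \<le> B\<^sup>2 * (norm (u x))\<^sup>2"
    using assms(3) by eventually_elim (auto simp: norm_mult power_mult_distrib intro!: mult_right_mono power_mono)
qed (use assms in \<open>auto simp: L2_def\<close>)

lemma L2_mult_continuous:
  assumes "u \<in> L2 \<Omega>" "continuous_on UNIV F"
  shows "(\<lambda>x. F x * u x) \<in> L2 \<Omega>"
proof -
  obtain B where "\<And>x. x \<in> \<Omega> \<Longrightarrow> norm (F x) \<le> B"
    using continuous_bounded[OF assms(2)] by blast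
  then show ?thesis
    by (intro L2_mult_bounded[OF assms(1), where B = B] AE_M_I continuous_measurable assms)
qed

lemma norm_add_sq_le: "(norm (a + b))\<^sup>2 \<le> 2 * (norm a)\<^sup>2 + 2 * (norm b)\<^sup>2" for a b :: "'b::real_normed_vector"
proof -
  have "(norm (a + b))\<^sup>2 \<le> (norm a + norm b)\<^sup>2" by (intro power_mono norm_triangle_ineq) auto
  also have "\<dots> \<le> 2 * (norm a)\<^sup>2 + 2 * (norm b)\<^sup>2" using sum_squares_bound[of "norm a" "norm b"]
    by (simp add: power2_sum)
  finally show ?thesis .
qed

lemma L2_add:
  assumes "u \<in> L2 \<Omega>" "v \<in> L2 \<Omega>"
  shows "(\<lambda>x. u x + v x) \<in> L2 \<Omega>"
  by (rule L2_dominated[of _ "\<lambda>x. 2 * (norm (u x))\<^sup>2 + 2 * (norm (v x))\<^sup>2"])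
    (use assms norm_add_sq_le in \<open>auto simp: L2_def\<close>)

lemma L2_cmult: "u \<in> L2 \<Omega> \<Longrightarrow> (\<lambda>x. c * u x) \<in> L2 \<Omega>"
  by (rule L2_mult_continuous) auto

lemma L2_cnj: "u \<in> L2 \<Omega> \<Longrightarrow> (\<lambda>x. cnj (u x)) \<in> L2 \<Omega>"
  by (auto simp: L2_def intro: borel_measurable_continuous_on[OF continuous_on_cnj[OF continuous_on_id]])

lemma norm_mult_le_sq: "norm a * norm b \<le> ((norm a)\<^sup>2 + (norm b)\<^sup>2) / 2"
  for a :: "'b::real_normed_vector" and b :: "'c::real_normed_vector"
  using sum_squares_bound[of "norm a" "norm b"] by simp

lemma L2_mult_integrable:
  assumes "u \<in> L2 \<Omega>" "v \<in> L2 \<Omega>"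
  shows "integrable M (\<lambda>x. u x * v x)"
proof (rule Bochner_Integration.integrable_bound)
  show "integrable M (\<lambda>x. ((norm (u x))\<^sup>2 + (norm (v x))\<^sup>2) / 2)"
    using assms by (simp add: L2_def)
  show "AE x in M. norm (u x * v x) \<le> norm (((norm (u x))\<^sup>2 + (norm (v x))\<^sup>2) / 2)"
    using norm_mult_le_sq by (intro AE_I2) (simp add: norm_mult)
qed (use assms in \<open>auto simp: L2_def\<close>)

lemma L2_norm_sq: "(L2_norm \<Omega> u)\<^sup>2 = (LINT x|M. (norm (u x))\<^sup>2)"
  by (simp add: L2_norm_def)

lemma L2_norm_nonneg: "L2_norm \<Omega> u \<ge> 0"
  by (simp add: L2_norm_def)

text \<open>Pointwise AM-GM with weight \<open>t\<close>, then the optimal \<open>t\<close>.\<close>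

lemma L2_Cauchy_Schwarz:
  assumes u: "u \<in> L2 \<Omega>" and v: "v \<in> L2 \<Omega>"
  shows "norm (LINT x|M. u x * v x) \<le> L2_norm \<Omega> u * L2_norm \<Omega> v"
proof -
  let ?I = "norm (LINT x|M. u x * v x)" and ?a = "L2_norm \<Omega> u" and ?b = "L2_norm \<Omega> v"
  have *: "2 * ?I \<le> t * ?a\<^sup>2 + ?b\<^sup>2 / t" if "t > 0" for t
  proof -
    have "?I \<le> (LINT x|M. norm (u x * v x))" by (rule integral_norm_bound)
    also have "\<dots> \<le> (LINT x|M. (t * (norm (u x))\<^sup>2 + (norm (v x))\<^sup>2 / t) / 2)"
    proof (rule integral_mono)
      show "integrable M (\<lambda>x. norm (u x * v x))" using L2_mult_integrable[OF u v] by simp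
      show "integrable M (\<lambda>x. (t * (norm (u x))\<^sup>2 + (norm (v x))\<^sup>2 / t) / 2)"
        using u v by (simp add: L2_def)
      show "norm (u x * v x) \<le> (t * (norm (u x))\<^sup>2 + (norm (v x))\<^sup>2 / t) / 2" for x
        using sum_squares_bound[of "t * norm (u x)" "norm (v x)"] that
        by (simp add: norm_mult field_simps power2_eq_square)
    qed
    also have "\<dots> = (t * ?a\<^sup>2 + ?b\<^sup>2 / t) / 2"
      using u v by (simp add: L2_norm_sq L2_def)
    finally show ?thesis by simp
  qed
  show ?thesis
  proof (cases "?a = 0 \<or> ?b = 0")
    case False
    then have pos: "?a > 0" "?b > 0" using L2_norm_nonneg by (auto simp: less_le)
    show ?thesis using *[of "?b / ?a"] pos by (simp add: field_simps power2_eq_square)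
  next
    case True
    \<comment> \<open>When a norm vanishes, the weight is sent to infinity or to 0 instead: the term
      containing that norm is 0 and the other one becomes at most \<open>e\<close>. The summand 1
      avoids a further case on the other norm.\<close>
    have "2 * ?I \<le> e" if "e > 0" for e
    proof (cases "?a = 0")
      case True
      have "?b\<^sup>2 * e \<le> e * (?b\<^sup>2 + 1)" using that by (simp add: algebra_simps)
      then have "?b\<^sup>2 / ((?b\<^sup>2 + 1) / e) \<le> e"
        by (simp add: pos_divide_le_eq add_nonneg_pos)
      moreover have "(?b\<^sup>2 + 1) / e > 0" using that by (simp add: add_nonneg_pos)
      ultimately show ?thesis using *[of "(?b\<^sup>2 + 1) / e"] True by simp
    next
      case F: False
      then have "?b = 0" using True by simp
      have "e * ?a\<^sup>2 \<le> e * (?a\<^sup>2 + 1)" using that by (simp add: algebra_simps)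
      then have "e / (?a\<^sup>2 + 1) * ?a\<^sup>2 \<le> e"
        by (simp add: pos_divide_le_eq add_nonneg_pos)
      moreover have "e / (?a\<^sup>2 + 1) > 0" using that by (simp add: add_nonneg_pos)
      ultimately show ?thesis using *[of "e / (?a\<^sup>2 + 1)"] \<open>?b = 0\<close> by simp
    qed
    then have "2 * ?I \<le> 0" by (rule field_le_epsilon[where y = 0, simplified])
    then show ?thesis using True by auto
  qed
qed

text \<open>Cauchy-Schwarz bounds the error of the pairing by the norm of the difference. The
  pairing is bilinear, without conjugation, to match the definition of weak derivatives.\<close>

lemma L2_limit_integral:
  assumes v: "\<And>k. v k \<in> L2 \<Omega>" and u: "u \<in> L2 \<Omega>" and w: "w \<in> L2 \<Omega>"
    and lim: "(\<lambda>k. L2_norm \<Omega> (\<lambda>x. v k x - u x)) \<longlonglongrightarrow> 0"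
  shows "(\<lambda>k. LINT x|M. w x * v k x) \<longlonglongrightarrow> (LINT x|M. w x * u x)"
proof (rule LIM_zero_cancel, rule Lim_null_comparison)
  show "\<forall>\<^sub>F k in sequentially. norm ((LINT x|M. w x * v k x) - (LINT x|M. w x * u x))
      \<le> L2_norm \<Omega> w * L2_norm \<Omega> (\<lambda>x. v k x - u x)"
  proof (rule always_eventually, rule allI)
    fix k
    have "(\<lambda>x. v k x + (- 1) * u x) \<in> L2 \<Omega>" by (intro L2_add L2_cmult u v)
    then have "norm (LINT x|M. w x * (v k x - u x)) \<le> L2_norm \<Omega> w * L2_norm \<Omega> (\<lambda>x. v k x - u x)"
      using L2_Cauchy_Schwarz[OF w] by simp
    then show "norm ((LINT x|M. w x * v k x) - (LINT x|M. w x * u x))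
      \<le> L2_norm \<Omega> w * L2_norm \<Omega> (\<lambda>x. v k x - u x)"
      using L2_mult_integrable[OF w v] L2_mult_integrable[OF w u] by (simp add: right_diff_distrib)
  qed
  show "(\<lambda>k. L2_norm \<Omega> w * L2_norm \<Omega> (\<lambda>x. v k x - u x)) \<longlonglongrightarrow> 0"
    using tendsto_mult_left[OF lim, of "L2_norm \<Omega> w"] by simp
qed

lemma L2_norm_cnj: "L2_norm \<Omega> (\<lambda>x. cnj (u x)) = L2_norm \<Omega> u"
  by (simp add: L2_norm_def)

text \<open>Testing with conjugates is what later turns limits of pairings into integrals of squared
  moduli.\<close>

lemma L2_limit_integral_cnj:
  assumes v: "\<And>k. v k \<in> L2 \<Omega>" and u: "u \<in> L2 \<Omega>" and w: "w \<in> L2 \<Omega>"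
    and lim: "(\<lambda>k. L2_norm \<Omega> (\<lambda>x. v k x - u x)) \<longlonglongrightarrow> 0"
  shows "(\<lambda>k. LINT x|M. w x * cnj (v k x)) \<longlonglongrightarrow> (LINT x|M. w x * cnj (u x))"
  by (rule L2_limit_integral[OF L2_cnj[OF v] L2_cnj[OF u] w])
    (use lim L2_norm_cnj[of "\<lambda>x. v k x - u x" for k] in simp)

lemma L2_norm_tendsto_0_iff:
  "((\<lambda>k. L2_norm \<Omega> (f k)) \<longlonglongrightarrow> 0) \<longleftrightarrow> ((\<lambda>k. LINT x|M. (norm (f k x))\<^sup>2) \<longlonglongrightarrow> 0)"
proof
  assume "(\<lambda>k. L2_norm \<Omega> (f k)) \<longlonglongrightarrow> 0"
  from tendsto_power[OF this, of 2] show "(\<lambda>k. LINT x|M. (norm (f k x))\<^sup>2) \<longlonglongrightarrow> 0"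
    by (simp add: L2_norm_sq)
next
  assume "(\<lambda>k. LINT x|M. (norm (f k x))\<^sup>2) \<longlonglongrightarrow> 0"
  from tendsto_real_sqrt[OF this] show "(\<lambda>k. L2_norm \<Omega> (f k)) \<longlonglongrightarrow> 0"
    by (simp add: L2_norm_def)
qed

lemma L2_limit_lincomb:
  assumes v: "\<And>k. v k \<in> L2 \<Omega>" "u \<in> L2 \<Omega>" "\<And>k. v' k \<in> L2 \<Omega>" "u' \<in> L2 \<Omega>"
    and lim: "(\<lambda>k. L2_norm \<Omega> (\<lambda>x. v k x - u x)) \<longlonglongrightarrow> 0"
      "(\<lambda>k. L2_norm \<Omega> (\<lambda>x. v' k x - u' x)) \<longlonglongrightarrow> 0"
    and c: "continuous_on UNIV c" "continuous_on UNIV d"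
  shows "(\<lambda>k. L2_norm \<Omega> (\<lambda>x. (c x * v k x + d x * v' k x) - (c x * u x + d x * u' x))) \<longlonglongrightarrow> 0"
proof -
  obtain C where C: "\<And>x. x \<in> \<Omega> \<Longrightarrow> norm (c x) \<le> C" using continuous_bounded[OF c(1)] by blast
  obtain D where D: "\<And>x. x \<in> \<Omega> \<Longrightarrow> norm (d x) \<le> D" using continuous_bounded[OF c(2)] by blast
  let ?a = "\<lambda>k x. v k x + (- 1) * u x" and ?b = "\<lambda>k x. v' k x + (- 1) * u' x"
  have ab: "?a k \<in> L2 \<Omega>" "?b k \<in> L2 \<Omega>" for k by (intro L2_add L2_cmult v)+
  have "(LINT x|M. (norm (c x * ?a k x + d x * ?b k x))\<^sup>2)
      \<le> (LINT x|M. 2 * C\<^sup>2 * (norm (?a k x))\<^sup>2 + 2 * D\<^sup>2 * (norm (?b k x))\<^sup>2)" for k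
  proof (rule integral_mono)
    show "integrable M (\<lambda>x. (norm (c x * ?a k x + d x * ?b k x))\<^sup>2)"
      by (intro L2_integrable L2_add L2_mult_continuous ab c)
    show "integrable M (\<lambda>x. 2 * C\<^sup>2 * (norm (?a k x))\<^sup>2 + 2 * D\<^sup>2 * (norm (?b k x))\<^sup>2)"
      by (intro Bochner_Integration.integrable_add integrable_mult_right L2_integrable ab)
    fix x assume "x \<in> space M"
    then have "x \<in> \<Omega>" by simp
    have "(norm (c x * ?a k x + d x * ?b k x))\<^sup>2 \<le> 2 * (norm (c x * ?a k x))\<^sup>2 + 2 * (norm (d x * ?b k x))\<^sup>2"
      by (rule norm_add_sq_le)
    also have "\<dots> \<le> 2 * C\<^sup>2 * (norm (?a k x))\<^sup>2 + 2 * D\<^sup>2 * (norm (?b k x))\<^sup>2"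
      using C[OF \<open>x \<in> \<Omega>\<close>] D[OF \<open>x \<in> \<Omega>\<close>] unfolding norm_mult power_mult_distrib mult.assoc
      by (intro add_mono mult_left_mono mult_right_mono power_mono) auto
    finally show "(norm (c x * ?a k x + d x * ?b k x))\<^sup>2 \<le> \<dots>" .
  qed
  moreover have "c x * ?a k x + d x * ?b k x = (c x * v k x + d x * v' k x) - (c x * u x + d x * u' x)" for k x
    by (simp add: algebra_simps)
  ultimately have *: "\<forall>\<^sub>F k in sequentially. norm (LINT x|M. (norm (c x * v k x + d x * v' k x - (c x * u x + d x * u' x)))\<^sup>2)
      \<le> 2 * C\<^sup>2 * (LINT x|M. (norm (?a k x))\<^sup>2) + 2 * D\<^sup>2 * (LINT x|M. (norm (?b k x))\<^sup>2)"
    using ab by (intro always_eventually allI) (simp add: L2_integrable)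
  have "(\<lambda>k. 2 * C\<^sup>2 * (LINT x|M. (norm (?a k x))\<^sup>2) + 2 * D\<^sup>2 * (LINT x|M. (norm (?b k x))\<^sup>2))
     \<longlonglongrightarrow> 2 * C\<^sup>2 * 0 + 2 * D\<^sup>2 * 0"
    using lim by (intro tendsto_intros) (simp_all add: L2_norm_tendsto_0_iff)
  then show ?thesis
    unfolding L2_norm_tendsto_0_iff by (intro Lim_null_comparison[OF *]) simp
qed

end

lemma partial_deriv_lincomb:
  fixes \<phi> \<psi> :: "'a::euclidean_space \<Rightarrow> complex"
  assumes "smooth_on UNIV \<phi>" "smooth_on UNIV \<psi>"
  shows "partial_deriv i (\<lambda>x. c * \<phi> x + d * \<psi> x) =
    (\<lambda>x. c * partial_deriv i \<phi> x + d * partial_deriv i \<psi> x)"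
  using assms by (simp add: partial_deriv_add smooth_on_mult
      bounded_linear.partial_deriv_compose[OF bounded_linear_mult_right])

context bounded_open_set
begin

subsection \<open>Weak derivatives of test functions\<close>

text \<open>A test function is its own extension by zero, so its integral can be moved to
  \<open>lborel\<close>, where translation invariance was used.\<close>

lemma integral_M_test:
  assumes "g \<in> test_functions \<Omega>"
  shows "(LINT x|M. g x) = (LINT x|lborel. g x)"
proof -
  have "(LINT x|M. g x) = (LINT x|lebesgue. indicator \<Omega> x *\<^sub>R g x)"
    by (rule integral_restrict_space[OF sets_Omega])
  also have "(\<lambda>x. indicator \<Omega> x *\<^sub>R g x) = g"
    using test_functions_outside[OF assms] by (auto simp: indicator_def)
  also have "(LINT x|lebesgue. g x) = (LINT x|lborel. g x)"
    by (intro integral_completion)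
      (simp add: borel_measurable_continuous_onI test_functions_continuous[OF assms])
  finally show ?thesis .
qed

text \<open>The product inherits compact support from \<psi>, so the integral of its partial
  derivative vanishes.\<close>

lemma integration_by_parts:
  assumes \<phi>: "smooth_on UNIV \<phi>" and \<psi>: "\<psi> \<in> test_functions \<Omega>" and i: "i \<in> Basis"
  shows "(LINT x|M. \<phi> x * partial_deriv i \<psi> x) = - (LINT x|M. partial_deriv i \<phi> x * \<psi> x)"
proof -
  have t: "(\<lambda>x. \<phi> x * \<psi> x) \<in> test_functions \<Omega>" by (rule test_functions_mult[OF \<psi> \<phi>])
  have \<psi>': "smooth_on UNIV \<psi>" by (rule test_functions_smooth[OF \<psi>])
  have "(LINT x|M. partial_deriv i (\<lambda>x. \<phi> x * \<psi> x) x) = 0"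
    using integral_partial_deriv_eq_0[OF t i] integral_M_test[OF test_functions_partial_deriv[OF t i]] by simp
  then have "(LINT x|M. \<phi> x * partial_deriv i \<psi> x + partial_deriv i \<phi> x * \<psi> x) = 0"
    by (simp add: partial_deriv_mult smooth_on_differentiable \<phi> \<psi>')
  moreover have "integrable M (\<lambda>x. \<phi> x * partial_deriv i \<psi> x)" "integrable M (\<lambda>x. partial_deriv i \<phi> x * \<psi> x)"
    by (intro continuous_integrable continuous_on_mult smooth_on_continuous smooth_on_partial_deriv \<phi> \<psi>' i)+
  ultimately show ?thesis by (simp add: eq_neg_iff_add_eq_0)
qed

lemma weak_partial_test:
  assumes "\<phi> \<in> test_functions \<Omega>" "i \<in> Basis"
  shows "weak_partial \<Omega> i \<phi> (partial_deriv i \<phi>)"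
  using assms integration_by_parts[OF test_functions_smooth[OF assms(1)]]
  by (simp add: weak_partial_def test_functions_L2 test_functions_partial_deriv)

lemma integral_mult_laplacian:
  assumes "u \<in> L2 \<Omega>" "\<psi> \<in> test_functions \<Omega>"
  shows "(LINT x|M. u x * laplacian \<psi> x) = (\<Sum>i\<in>Basis. LINT x|M. u x * partial_deriv i (partial_deriv i \<psi>) x)"
  unfolding laplacian_def sum_distrib_left
  by (intro Bochner_Integration.integral_sum L2_mult_integrable assms test_functions_L2 test_functions_partial_deriv)

lemma integration_by_parts_laplacian:
  assumes \<phi>: "smooth_on UNIV \<phi>" and \<psi>: "\<psi> \<in> test_functions \<Omega>"
  shows "(LINT x|M. \<phi> x * laplacian \<psi> x) = (LINT x|M. laplacian \<phi> x * \<psi> x)"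
proof -
  have "(LINT x|M. \<phi> x * laplacian \<psi> x) = (\<Sum>i\<in>Basis. LINT x|M. \<phi> x * partial_deriv i (partial_deriv i \<psi>) x)"
    by (intro integral_mult_laplacian continuous_L2 smooth_on_continuous \<phi> \<psi>)
  also have "\<dots> = (\<Sum>i\<in>Basis. LINT x|M. partial_deriv i (partial_deriv i \<phi>) x * \<psi> x)"
    by (intro sum.cong refl)
      (simp add: integration_by_parts \<phi> \<psi> test_functions_partial_deriv smooth_on_partial_deriv)
  also have "\<dots> = (LINT x|M. laplacian \<phi> x * \<psi> x)"
    unfolding laplacian_def sum_distrib_right
    by (intro Bochner_Integration.integral_sum[symmetric] continuous_integrable continuous_on_mult
        smooth_on_continuous smooth_on_partial_deriv \<phi> test_functions_smooth[OF \<psi>])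
  finally show ?thesis .
qed

lemma weak_laplacian_test:
  assumes "\<phi> \<in> test_functions \<Omega>"
  shows "weak_laplacian \<Omega> \<phi> (laplacian \<phi>)"
  using assms integration_by_parts_laplacian[OF test_functions_smooth[OF assms]]
  by (simp add: weak_laplacian_def test_functions_L2 test_functions_laplacian)

lemma H10_test:
  assumes "\<phi> \<in> test_functions \<Omega>"
  shows "\<phi> \<in> H10 \<Omega>"
  unfolding H10_def
  using assms
  by (auto intro!: exI[of _ "\<lambda>i. partial_deriv i \<phi>"] exI[of _ "\<lambda>_::nat. \<phi>"] test_functions_L2 weak_partial_test
      simp: L2_norm_def)

lemma dirichlet_realization_test:
  assumes "\<phi> \<in> test_functions \<Omega>" "continuous_on UNIV p"
  shows "dirichlet_realization \<Omega> p \<phi> (\<lambda>x. - laplacian \<phi> x + complex_of_real (p x) * \<phi> x)"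
proof -
  have "(\<lambda>x. (- 1) * laplacian \<phi> x + complex_of_real (p x) * \<phi> x) \<in> L2 \<Omega>"
    using assms by (intro L2_add L2_cmult L2_mult_continuous test_functions_L2 test_functions_laplacian continuous_intros)
  then show ?thesis
    using assms unfolding dirichlet_realization_def
    by (auto intro: H10_test weak_laplacian_test)
qed

subsection \<open>Uniqueness for the Dirichlet problem\<close>

text \<open>Integrate the derivative of \<open>(x \<bullet> i) * \<bar>\<phi>\<bar>\<^sup>2\<close>.\<close>

lemma Poincare_inequality:
  assumes i: "i \<in> Basis"
  shows "\<exists>C. \<forall>\<phi>\<in>test_functions \<Omega>. (LINT x|M. (norm (\<phi> x))\<^sup>2) \<le> C * (LINT x|M. (norm (partial_deriv i \<phi> x))\<^sup>2)"
proof -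
  obtain R where R: "R > 0" "\<And>x. x \<in> \<Omega> \<Longrightarrow> norm x \<le> R"
    using bounded_set unfolding bounded_pos by blast
  have "(LINT x|M. (norm (\<phi> x))\<^sup>2) \<le> 4 * R\<^sup>2 * (LINT x|M. (norm (partial_deriv i \<phi> x))\<^sup>2)"
    if \<phi>: "\<phi> \<in> test_functions \<Omega>" for \<phi>
  proof -
    let ?D = "partial_deriv i \<phi>" and ?s = "\<lambda>x. complex_of_real (x \<bullet> i)"
    have sm: "smooth_on UNIV \<phi>" by (rule test_functions_smooth[OF \<phi>])
    have smc: "smooth_on UNIV (\<lambda>x. cnj (\<phi> x))"
      by (rule bounded_linear.smooth_on_compose[OF bounded_linear_cnj sm])
    have sms: "smooth_on UNIV ?s"
      by (rule bounded_linear.smooth_on_compose[OF bounded_linear_of_real smooth_on_inner_left])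
    have ds: "partial_deriv i ?s x = 1" for x
    proof -
      have "(?s has_derivative (\<lambda>h. complex_of_real (h \<bullet> i))) (at x)"
        by (auto intro!: derivative_eq_intros)
      from partial_deriv_has_derivative[OF this, of i] show ?thesis using i by simp
    qed
    have dc: "partial_deriv i (\<lambda>x. cnj (\<phi> x)) x = cnj (?D x)" for x
      by (simp add: bounded_linear.partial_deriv_compose[OF bounded_linear_cnj sm])
    have d: "partial_deriv i (\<lambda>x. ?s x * cnj (\<phi> x)) x = ?s x * cnj (?D x) + cnj (\<phi> x)" for x
      using partial_deriv_mult[OF smooth_on_differentiable[OF sms] smooth_on_differentiable[OF smc], where i=i]
      by (simp add: ds dc)
    have cont: "continuous_on UNIV \<phi>" "continuous_on UNIV ?D"
      by (intro smooth_on_continuous smooth_on_partial_deriv sm i)+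
    have int: "integrable M (\<lambda>x. (norm (\<phi> x))\<^sup>2)" "integrable M (\<lambda>x. (norm (?D x))\<^sup>2)"
      by (intro L2_integrable continuous_L2 cont)+
    have rearrange: "c = - a - b" if "a = - b - c" for a b c :: complex using that by simp
    have "(LINT x|M. ?s x * cnj (\<phi> x) * ?D x) = - (LINT x|M. (?s x * cnj (?D x) + cnj (\<phi> x)) * \<phi> x)"
      using integration_by_parts[OF smooth_on_mult[OF sms smc] \<phi> i] by (simp add: d)
    also have "\<dots> = - (LINT x|M. ?s x * cnj (?D x) * \<phi> x) - (LINT x|M. cnj (\<phi> x) * \<phi> x)"
      using cont by (simp add: distrib_right continuous_integrable continuous_intros)
    finally have "(LINT x|M. cnj (\<phi> x) * \<phi> x) =
        - (LINT x|M. ?s x * cnj (\<phi> x) * ?D x) - (LINT x|M. ?s x * cnj (?D x) * \<phi> x)"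
      by (rule rearrange)
    also have "\<dots> = - (LINT x|M. ?s x * cnj (\<phi> x) * ?D x + ?s x * cnj (?D x) * \<phi> x)"
      using cont by (simp add: continuous_integrable continuous_intros)
    finally have eq: "(LINT x|M. cnj (\<phi> x) * \<phi> x) = \<dots>" .
    have "cnj (\<phi> x) * \<phi> x = complex_of_real ((norm (\<phi> x))\<^sup>2)" for x
      by (metis complex_norm_square mult.commute)
    then have "(LINT x|M. cnj (\<phi> x) * \<phi> x) = complex_of_real (LINT x|M. (norm (\<phi> x))\<^sup>2)"
      by (simp del: of_real_power)
    then have "(LINT x|M. (norm (\<phi> x))\<^sup>2) = norm (LINT x|M. cnj (\<phi> x) * \<phi> x)"
      by (simp add: integral_nonneg_AE)
    also have "\<dots> \<le> (LINT x|M. norm (?s x * cnj (\<phi> x) * ?D x + ?s x * cnj (?D x) * \<phi> x))"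
      unfolding eq norm_minus_cancel by (rule integral_norm_bound)
    \<comment> \<open>The weights are chosen so that only half of the integral of the squared
      modulus of \<phi> appears. It is absorbed on the left, which doubles 2 \<open>R\<close>
      squared to the constant 4 \<open>R\<close> squared.\<close>
    also have "\<dots> \<le> (LINT x|M. (norm (\<phi> x))\<^sup>2 / 2 + 2 * R\<^sup>2 * (norm (?D x))\<^sup>2)"
    proof (rule integral_mono)
      show "integrable M (\<lambda>x. norm (?s x * cnj (\<phi> x) * ?D x + ?s x * cnj (?D x) * \<phi> x))"
        using cont by (intro continuous_integrable continuous_intros)
      show "integrable M (\<lambda>x. (norm (\<phi> x))\<^sup>2 / 2 + 2 * R\<^sup>2 * (norm (?D x))\<^sup>2)" using int by simp
      fix x assume "x \<in> space M"
      then have "\<bar>x \<bullet> i\<bar> \<le> R" using R(2)[of x] Basis_le_norm[OF i, of x] by simp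
      then have "\<bar>x \<bullet> i\<bar> * (norm (\<phi> x) * norm (?D x)) \<le> R * (norm (\<phi> x) * norm (?D x))"
        by (intro mult_right_mono) auto
      moreover have "norm (?s x * cnj (\<phi> x) * ?D x + ?s x * cnj (?D x) * \<phi> x)
          \<le> 2 * (\<bar>x \<bullet> i\<bar> * (norm (\<phi> x) * norm (?D x)))"
        by (rule norm_triangle_le) (simp add: norm_mult mult_ac)
      moreover have "2 * (R * (norm (\<phi> x) * norm (?D x))) \<le> (norm (\<phi> x))\<^sup>2 / 2 + 2 * R\<^sup>2 * (norm (?D x))\<^sup>2"
        using sum_squares_bound[of "norm (\<phi> x)" "2 * R * norm (?D x)"]
        by (simp add: power_mult_distrib mult_ac)
      ultimately show "norm (?s x * cnj (\<phi> x) * ?D x + ?s x * cnj (?D x) * \<phi> x)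
          \<le> (norm (\<phi> x))\<^sup>2 / 2 + 2 * R\<^sup>2 * (norm (?D x))\<^sup>2" by linarith
    qed
    also have "\<dots> = (LINT x|M. (norm (\<phi> x))\<^sup>2) / 2 + 2 * R\<^sup>2 * (LINT x|M. (norm (?D x))\<^sup>2)"
      using int by simp
    finally show ?thesis by simp
  qed
  then show ?thesis by blast
qed

section \<open>Linearity of weak derivatives and of the Dirichlet realization\<close>

lemma integral_lincomb:
  fixes f g :: "'a \<Rightarrow> complex"
  assumes "u \<in> L2 \<Omega>" "v \<in> L2 \<Omega>" "\<psi> \<in> L2 \<Omega>"
  shows "(LINT x|M. (c * u x + d * v x) * \<psi> x) = c * (LINT x|M. u x * \<psi> x) + d * (LINT x|M. v x * \<psi> x)"
  using L2_mult_integrable[OF assms(1,3)] L2_mult_integrable[OF assms(2,3)]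
  by (simp add: distrib_right mult.assoc)

lemma weak_partial_lincomb:
  assumes "weak_partial \<Omega> i u g" "weak_partial \<Omega> i v h" "i \<in> Basis"
  shows "weak_partial \<Omega> i (\<lambda>x. c * u x + d * v x) (\<lambda>x. c * g x + d * h x)"
  using assms unfolding weak_partial_def
  by (auto intro!: L2_add L2_cmult simp: integral_lincomb test_functions_L2 test_functions_partial_deriv)

lemma weak_laplacian_lincomb:
  assumes "weak_laplacian \<Omega> u g" "weak_laplacian \<Omega> v h"
  shows "weak_laplacian \<Omega> (\<lambda>x. c * u x + d * v x) (\<lambda>x. c * g x + d * h x)"
  using assms unfolding weak_laplacian_def
  by (auto intro!: L2_add L2_cmult simp: integral_lincomb test_functions_L2 test_functions_laplacian)

lemma H10_lincomb:
  assumes "u \<in> H10 \<Omega>" "v \<in> H10 \<Omega>"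
  shows "(\<lambda>x. c * u x + d * v x) \<in> H10 \<Omega>"
proof -
  obtain G \<phi> where u: "u \<in> L2 \<Omega>" "\<And>i. i \<in> Basis \<Longrightarrow> weak_partial \<Omega> i u (G i)"
    "\<And>k::nat. \<phi> k \<in> test_functions \<Omega>" "(\<lambda>k. L2_norm \<Omega> (\<lambda>x. \<phi> k x - u x)) \<longlonglongrightarrow> 0"
    "\<And>i. i \<in> Basis \<Longrightarrow> (\<lambda>k. L2_norm \<Omega> (\<lambda>x. partial_deriv i (\<phi> k) x - G i x)) \<longlonglongrightarrow> 0"
    using assms(1) unfolding H10_def by blast
  obtain H \<psi> where v: "v \<in> L2 \<Omega>" "\<And>i. i \<in> Basis \<Longrightarrow> weak_partial \<Omega> i v (H i)"
    "\<And>k::nat. \<psi> k \<in> test_functions \<Omega>" "(\<lambda>k. L2_norm \<Omega> (\<lambda>x. \<psi> k x - v x)) \<longlonglongrightarrow> 0"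
    "\<And>i. i \<in> Basis \<Longrightarrow> (\<lambda>k. L2_norm \<Omega> (\<lambda>x. partial_deriv i (\<psi> k) x - H i x)) \<longlonglongrightarrow> 0"
    using assms(2) unfolding H10_def by blast
  let ?\<chi> = "\<lambda>k x. c * \<phi> k x + d * \<psi> k x" and ?K = "\<lambda>i x. c * G i x + d * H i x"
  have L2: "G i \<in> L2 \<Omega>" "H i \<in> L2 \<Omega>" if "i \<in> Basis" for i
    using u(2) v(2) that by (auto simp: weak_partial_def)
  have "?\<chi> k \<in> test_functions \<Omega>" for k
    using u(3) v(3) by (intro test_functions_add test_functions_mult smooth_on_const)
  moreover have "(\<lambda>k. L2_norm \<Omega> (\<lambda>x. ?\<chi> k x - (c * u x + d * v x))) \<longlonglongrightarrow> 0"
    using u v by (intro L2_limit_lincomb) (auto intro: test_functions_L2)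
  moreover have "(\<lambda>k. L2_norm \<Omega> (\<lambda>x. partial_deriv i (?\<chi> k) x - ?K i x)) \<longlonglongrightarrow> 0" if "i \<in> Basis" for i
    unfolding partial_deriv_lincomb[OF test_functions_smooth[OF u(3)] test_functions_smooth[OF v(3)]]
    by (intro L2_limit_lincomb test_functions_L2 test_functions_partial_deriv u v that L2 continuous_on_const)
  moreover have "weak_partial \<Omega> i (\<lambda>x. c * u x + d * v x) (?K i)" if "i \<in> Basis" for i
    using that u(2) v(2) by (intro weak_partial_lincomb)
  moreover have "(\<lambda>x. c * u x + d * v x) \<in> L2 \<Omega>" by (intro L2_add L2_cmult u v)
  ultimately show ?thesis
    unfolding H10_def by (intro CollectI conjI exI[of _ ?K] exI[of _ ?\<chi>]) auto
qed

lemma dirichlet_realization_lincomb: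
  assumes "dirichlet_realization \<Omega> p u f" "dirichlet_realization \<Omega> p v h"
  shows "dirichlet_realization \<Omega> p (\<lambda>x. c * u x + d * v x) (\<lambda>x. c * f x + d * h x)"
proof -
  obtain g where g: "weak_laplacian \<Omega> u g" "AE x in M. f x = - g x + complex_of_real (p x) * u x"
    using assms(1) unfolding dirichlet_realization_def by blast
  obtain k where k: "weak_laplacian \<Omega> v k" "AE x in M. h x = - k x + complex_of_real (p x) * v x"
    using assms(2) unfolding dirichlet_realization_def by blast
  have "AE x in M. c * f x + d * h x = - (c * g x + d * k x) + complex_of_real (p x) * (c * u x + d * v x)"
    using g(2) k(2)
  proof eventually_elim
    case (elim x)
    show ?case unfolding elim by (simp add: algebra_simps)
  qed
  then show ?thesis
    using assms weak_laplacian_lincomb[OF g(1) k(1)] unfolding dirichlet_realization_def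
    by (intro conjI exI[of _ "\<lambda>x. c * g x + d * k x"]) (auto intro: H10_lincomb L2_add L2_cmult)
qed

lemma norm_sq_integral_eq_0:
  assumes "u \<in> L2 \<Omega>" "(LINT x|M. (norm (u x))\<^sup>2) = 0"
  shows "AE x in M. u x = 0"
  using assms integral_nonneg_eq_0_iff_AE[OF L2_integrable[OF assms(1)]] by simp

lemma mult_cnj_norm: "z * cnj z = complex_of_real ((norm z)\<^sup>2)"
  by (metis complex_norm_square)

text \<open>Energy argument: pairing the equation with the conjugate of \<open>v\<close> gives that
  the integral of \<open>p\<close> times the squared modulus of \<open>v\<close>, plus that of the
  squared gradient, is 0. Both terms are nonnegative, so the gradient vanishes, and the Poincare
  inequality removes \<open>v\<close> itself.\<close>

lemma H10_weak_laplacian_unique: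
  assumes v: "v \<in> H10 \<Omega>" and g: "weak_laplacian \<Omega> v g" and p: "continuous_on UNIV p"
    and pos: "\<forall>x\<in>\<Omega>. p x \<ge> 0"
    and ae: "AE x in M. g x = complex_of_real (p x) * v x"
  shows "AE x in M. v x = 0"
proof -
  obtain G \<phi> where L2v: "v \<in> L2 \<Omega>" and G: "\<And>i. i \<in> Basis \<Longrightarrow> weak_partial \<Omega> i v (G i)"
    and \<phi>: "\<And>k::nat. \<phi> k \<in> test_functions \<Omega>" and lim: "(\<lambda>k. L2_norm \<Omega> (\<lambda>x. \<phi> k x - v x)) \<longlonglongrightarrow> 0"
    and limG: "\<And>i. i \<in> Basis \<Longrightarrow> (\<lambda>k. L2_norm \<Omega> (\<lambda>x. partial_deriv i (\<phi> k) x - G i x)) \<longlonglongrightarrow> 0"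
    using v unfolding H10_def by blast
  have L2G: "G i \<in> L2 \<Omega>" if "i \<in> Basis" for i using G[OF that] by (simp add: weak_partial_def)
  have L2g: "g \<in> L2 \<Omega>" using g by (simp add: weak_laplacian_def)
  have dcnj: "partial_deriv i (\<lambda>x. cnj (\<phi> k x)) = (\<lambda>x. cnj (partial_deriv i (\<phi> k) x))" for i k
    by (rule bounded_linear.partial_deriv_compose[OF bounded_linear_cnj test_functions_smooth[OF \<phi>]])
  \<comment> \<open>Only test functions may be inserted into the weak equation, so \<open>v\<close>
    is replaced by its approximants and the limit is taken afterwards.\<close>
  have "(LINT x|M. g x * cnj (\<phi> k x)) = - (\<Sum>i\<in>Basis. LINT x|M. G i x * cnj (partial_deriv i (\<phi> k) x))" for k
  proof -
    let ?\<psi> = "\<lambda>x. cnj (\<phi> k x)"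
    have \<psi>: "?\<psi> \<in> test_functions \<Omega>" by (rule test_functions_cnj[OF \<phi>])
    have "(LINT x|M. g x * ?\<psi> x) = (LINT x|M. v x * laplacian ?\<psi> x)"
      using g \<psi> unfolding weak_laplacian_def by simp
    also have "\<dots> = (\<Sum>i\<in>Basis. LINT x|M. v x * partial_deriv i (partial_deriv i ?\<psi>) x)"
      by (rule integral_mult_laplacian[OF L2v \<psi>])
    also have "\<dots> = (\<Sum>i\<in>Basis. - (LINT x|M. G i x * partial_deriv i ?\<psi> x))"
    proof (intro sum.cong refl)
      fix i :: 'a assume "i \<in> Basis"
      then show "(LINT x|M. v x * partial_deriv i (partial_deriv i ?\<psi>) x) = - (LINT x|M. G i x * partial_deriv i ?\<psi> x)"
        using G[unfolded weak_partial_def, THEN conjunct2, THEN conjunct2, rule_format] test_functions_partial_deriv[OF \<psi>]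
        by simp
    qed
    finally show ?thesis by (simp add: dcnj sum_negf)
  qed
  with L2_limit_integral_cnj[OF test_functions_L2[OF \<phi>] L2v L2g lim]
  have "(\<lambda>k. - (\<Sum>i\<in>Basis. LINT x|M. G i x * cnj (partial_deriv i (\<phi> k) x))) \<longlonglongrightarrow> (LINT x|M. g x * cnj (v x))"
    by (simp only:)
  moreover have "(\<lambda>k. - (\<Sum>i\<in>Basis. LINT x|M. G i x * cnj (partial_deriv i (\<phi> k) x)))
      \<longlonglongrightarrow> - (\<Sum>i\<in>Basis. LINT x|M. G i x * cnj (G i x))"
    by (intro tendsto_minus tendsto_sum L2_limit_integral_cnj limG L2G test_functions_L2 test_functions_partial_deriv \<phi>)
  ultimately have "(LINT x|M. g x * cnj (v x)) = - (\<Sum>i\<in>Basis. LINT x|M. G i x * cnj (G i x))"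
    by (rule LIMSEQ_unique)
  moreover have "(LINT x|M. g x * cnj (v x)) = (LINT x|M. complex_of_real (p x * (norm (v x))\<^sup>2))"
  proof (rule integral_cong_AE)
    show "AE x in M. g x * cnj (v x) = complex_of_real (p x * (norm (v x))\<^sup>2)"
      using ae by eventually_elim (simp add: mult.assoc mult_cnj_norm del: of_real_power)
    show "(\<lambda>x. g x * cnj (v x)) \<in> borel_measurable M"
      using L2_mult_integrable[OF L2g L2_cnj[OF L2v]] by simp
    have "(\<lambda>x. complex_of_real (p x)) \<in> borel_measurable M" by (intro continuous_measurable continuous_intros p)
    then show "(\<lambda>x. complex_of_real (p x * (norm (v x))\<^sup>2)) \<in> borel_measurable M"
      using L2_measurable[OF L2v] by simp
  qed
  ultimately have "complex_of_real ((LINT x|M. p x * (norm (v x))\<^sup>2) + (\<Sum>i\<in>Basis. LINT x|M. (norm (G i x))\<^sup>2)) = 0"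
    by (simp add: mult_cnj_norm del: of_real_power of_real_mult)
  then have "(LINT x|M. p x * (norm (v x))\<^sup>2) + (\<Sum>i\<in>Basis. LINT x|M. (norm (G i x))\<^sup>2) = 0"
    using of_real_eq_0_iff by blast
  moreover have "(LINT x|M. p x * (norm (v x))\<^sup>2) \<ge> 0"
    by (intro integral_nonneg_AE AE_M_I) (simp add: pos)
  moreover have "(\<Sum>i\<in>Basis. LINT x|M. (norm (G i x))\<^sup>2) \<ge> 0" by (simp add: sum_nonneg)
  ultimately have "(\<Sum>i\<in>Basis. LINT x|M. (norm (G i x))\<^sup>2) = 0" by linarith
  then have G0: "(LINT x|M. (norm (G i x))\<^sup>2) = 0" if "i \<in> Basis" for i
    using that sum_nonneg_eq_0_iff[of Basis "\<lambda>i. LINT x|M. (norm (G i x))\<^sup>2"] by simp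
  obtain i :: 'a where i: "i \<in> Basis" using nonempty_Basis by blast
  obtain C where C: "\<forall>\<phi>\<in>test_functions \<Omega>. (LINT x|M. (norm (\<phi> x))\<^sup>2) \<le> C * (LINT x|M. (norm (partial_deriv i \<phi> x))\<^sup>2)"
    using Poincare_inequality[OF i] ..
  \<comment> \<open>The Poincare inequality is available for test functions; it is applied to the
    approximants, whose derivatives tend to the vanishing weak derivative
    \<open>G i\<close>.\<close>
  have "(\<lambda>k. LINT x|M. (norm (partial_deriv i (\<phi> k) x))\<^sup>2) \<longlonglongrightarrow> 0"
  proof -
    have "(LINT x|M. (norm (partial_deriv i (\<phi> k) x - G i x))\<^sup>2) = (LINT x|M. (norm (partial_deriv i (\<phi> k) x))\<^sup>2)" for k
    proof (rule integral_cong_AE)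
      show "AE x in M. (norm (partial_deriv i (\<phi> k) x - G i x))\<^sup>2 = (norm (partial_deriv i (\<phi> k) x))\<^sup>2"
        using norm_sq_integral_eq_0[OF L2G[OF i] G0[OF i]] by eventually_elim simp
    qed (use L2_measurable[OF L2G[OF i]]
        L2_measurable[OF test_functions_L2[OF test_functions_partial_deriv[OF \<phi> i]]] in simp_all)
    then show ?thesis using limG[OF i] by (simp add: L2_norm_tendsto_0_iff)
  qed
  from tendsto_mult_right_zero[OF this, of C]
  have "(\<lambda>k. LINT x|M. (norm (\<phi> k x))\<^sup>2) \<longlonglongrightarrow> 0"
    by (rule Lim_null_comparison[rotated]) (use C[rule_format, OF \<phi>] in simp)
  then have "(\<lambda>k. L2_norm \<Omega> (\<lambda>x. \<phi> k x - 0)) \<longlonglongrightarrow> 0" by (simp add: L2_norm_tendsto_0_iff)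
  \<comment> \<open>The approximants converge both to 0 and to \<open>v\<close>; pairing them with
    \<open>v\<close> and comparing the two limits gives norm 0.\<close>
  then have "(\<lambda>k. LINT x|M. v x * cnj (\<phi> k x)) \<longlonglongrightarrow> (LINT x|M. v x * cnj 0)"
    by (intro L2_limit_integral_cnj test_functions_L2 \<phi> L2v test_functions_zero)
  moreover have "(\<lambda>k. LINT x|M. v x * cnj (\<phi> k x)) \<longlonglongrightarrow> (LINT x|M. v x * cnj (v x))"
    by (intro L2_limit_integral_cnj test_functions_L2 \<phi> L2v lim)
  ultimately have "(LINT x|M. v x * cnj 0) = (LINT x|M. v x * cnj (v x))" by (rule LIMSEQ_unique)
  then have "(LINT x|M. v x * cnj (v x)) = 0" by simp
  then have "(LINT x|M. (norm (v x))\<^sup>2) = 0"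
    by (simp add: mult_cnj_norm del: of_real_power)
  then show ?thesis by (rule norm_sq_integral_eq_0[OF L2v])
qed

lemma dirichlet_realization_unique:
  assumes p: "continuous_on UNIV p" and pos: "\<forall>x\<in>\<Omega>. p x \<ge> 0"
    and u: "dirichlet_realization \<Omega> p u f" and v: "dirichlet_realization \<Omega> p v f"
  shows "AE x in M. u x = v x"
proof -
  let ?w = "\<lambda>x. 1 * u x + (- 1) * v x"
  have "dirichlet_realization \<Omega> p ?w (\<lambda>x. 1 * f x + (- 1) * f x)"
    by (rule dirichlet_realization_lincomb[OF u v])
  then obtain g where "?w \<in> H10 \<Omega>" "weak_laplacian \<Omega> ?w g" "AE x in M. 0 = - g x + complex_of_real (p x) * ?w x"
    unfolding dirichlet_realization_def by auto
  then have "AE x in M. ?w x = 0"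
    by (intro H10_weak_laplacian_unique[OF _ _ p pos, of ?w g]) (auto simp: add_eq_0_iff)
  then show ?thesis by simp
qed

end

section \<open>Bumps and dented bumps as test functions\<close>

lemma bump_outside: "d > 0 \<Longrightarrow> x \<notin> ball y d \<Longrightarrow> bump y d x = 0"
  using bump_pos_iff[of d y x] bump_nonneg[of y d x] by linarith

lemma bump_test:
  assumes "d > 0" "cball y d \<subseteq> S"
  shows "(\<lambda>x. complex_of_real (bump y d x)) \<in> test_functions S"
  by (rule test_functions_of_real[OF smooth_on_bump _ assms(2)]) (use assms in \<open>auto intro: bump_outside\<close>)

lemma dented_bump_test:
  assumes "d > 0" "cball y d \<subseteq> S"
  shows "(\<lambda>x. complex_of_real (dented_bump e y d x)) \<in> test_functions S"
  by (rule test_functions_of_real[OF smooth_on_dented_bump _ assms(2)])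
    (use assms in \<open>auto simp: dented_bump_def intro: bump_outside\<close>)

lemma dented_bump_outside: "d > 0 \<Longrightarrow> x \<notin> ball y d \<Longrightarrow> dented_bump e y d x = 0"
  by (simp add: dented_bump_def bump_outside)

text \<open>The centre is a zero, so positivity is witnessed halfway to the boundary of the ball
  along \<open>e\<close>, where both factors are positive.\<close>

lemma dented_bump_pos:
  assumes "d > 0" "e \<in> Basis"
  shows "dented_bump e y d (y + (d / 2) *\<^sub>R e) > 0"
proof -
  have "bump y d (y + (d / 2) *\<^sub>R e) > 0" using assms by (simp add: bump_pos_iff dist_norm)
  then show ?thesis using assms by (simp add: dented_bump_def)
qed

lemma laplacian_of_real:
  "smooth_on UNIV f \<Longrightarrow> laplacian (\<lambda>x. complex_of_real (f x)) x = complex_of_real (laplacian f x)"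
  by (simp add: bounded_linear.laplacian_compose[OF bounded_linear_of_real])

context bounded_open_set
begin

subsection \<open>Localization\<close>

text \<open>The set in \<Omega> where \<open>F\<close> is nonzero is open and negligible, hence
  empty.\<close>

lemma AE_zero_continuous:
  fixes F :: "'a \<Rightarrow> 'b::real_normed_vector"
  assumes "AE x in M. F x = 0" "continuous_on UNIV F" "x \<in> \<Omega>"
  shows "F x = 0"
proof (rule ccontr)
  assume "F x \<noteq> 0"
  have "AE x in lebesgue. x \<in> \<Omega> \<longrightarrow> F x = 0"
    using assms(1) AE_restrict_space_iff[OF sets_Omega] by simp
  then obtain N where "N \<in> null_sets lebesgue" "{x. \<not> (x \<in> \<Omega> \<longrightarrow> F x = 0)} \<subseteq> N"
    unfolding eventually_ae_filter by auto
  then have "negligible (\<Omega> \<inter> {x. F x \<noteq> 0})"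
    by (intro negligible_subset[of N "\<Omega> \<inter> {x. F x \<noteq> 0}"]) (auto simp: negligible_iff_null_sets)
  moreover have "open (\<Omega> \<inter> {x. F x \<noteq> 0})"
    by (intro open_Int open_set open_Collect_neq assms continuous_on_const)
  ultimately have "\<Omega> \<inter> {x. F x \<noteq> 0} = {}" using open_not_negligible by blast
  then show False using assms(3) \<open>F x \<noteq> 0\<close> by blast
qed

text \<open>Dented bumps concentrate at \<open>y\<close> although they vanish there. Assuming
  measurability and continuity only at \<open>y\<close> matters later, when \<Phi> contains a
  quotient whose denominator may vanish elsewhere.\<close>

lemma eq_0_if_integral_dented_bump_eq_0:
  fixes \<Phi> :: "'a \<Rightarrow> complex"
  assumes e: "e \<in> Basis" and r: "r > 0" "cball y r \<subseteq> \<Omega>"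
    and meas: "\<Phi> \<in> borel_measurable M" and cont: "isCont \<Phi> y"
    and zero: "\<And>d. 0 < d \<Longrightarrow> d \<le> r \<Longrightarrow> (LINT x|M. complex_of_real (dented_bump e y d x) * \<Phi> x) = 0"
  shows "\<Phi> y = 0"
proof (rule ccontr)
  assume nz: "\<Phi> y \<noteq> 0"
  then obtain s where s: "s > 0" "\<And>x. dist x y < s \<Longrightarrow> dist (\<Phi> x) (\<Phi> y) < norm (\<Phi> y) / 2"
    using cont unfolding continuous_at_eps_delta by (metis half_gt_zero zero_less_norm_iff)
  define d where "d = min r s"
  have d: "d > 0" "d \<le> r" "d \<le> s" using r s by (auto simp: d_def)
  let ?h = "dented_bump e y d"
  have contd: "continuous_on UNIV ?h" by (rule smooth_on_continuous[OF smooth_on_dented_bump])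
  have near: "?h x * norm (\<Phi> x - \<Phi> y) \<le> ?h x * (norm (\<Phi> y) / 2)" for x
  proof (cases "x \<in> ball y d")
    case True
    then have "dist x y < s" using d by (simp add: dist_commute)
    then have "norm (\<Phi> x - \<Phi> y) \<le> norm (\<Phi> y) / 2" using s(2) by (auto simp: dist_norm intro: less_imp_le)
    then show ?thesis by (rule mult_left_mono) (rule dented_bump_nonneg)
  qed (use d in \<open>simp add: dented_bump_outside\<close>)
  have int: "integrable M ?h" by (rule continuous_integrable[OF contd])
  have hm: "?h \<in> borel_measurable M" by (rule continuous_measurable[OF contd])
  have int1: "integrable M (\<lambda>x. complex_of_real (?h x) * (\<Phi> x - \<Phi> y))"
  proof (rule Bochner_Integration.integrable_bound)
    show "integrable M (\<lambda>x. ?h x * (norm (\<Phi> y) / 2))" using int by simp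
    show "AE x in M. norm (complex_of_real (?h x) * (\<Phi> x - \<Phi> y)) \<le> norm (?h x * (norm (\<Phi> y) / 2))"
      using near dented_bump_nonneg[of e y d] by (intro AE_I2) (simp add: norm_mult)
  qed (use meas hm in simp)
  have int2: "integrable M (\<lambda>x. complex_of_real (?h x) * \<Phi> y)" using int by simp
  have "(LINT x|M. complex_of_real (?h x) * (\<Phi> x - \<Phi> y) + complex_of_real (?h x) * \<Phi> y) = 0"
    using zero[OF d(1,2)] by (simp add: algebra_simps)
  then have eq: "(LINT x|M. complex_of_real (?h x) * (\<Phi> x - \<Phi> y)) = - (complex_of_real (LINT x|M. ?h x) * \<Phi> y)"
    using int1 int2 by (simp add: eq_neg_iff_add_eq_0)
  have nn: "(LINT x|M. ?h x) \<ge> 0" by (intro integral_nonneg_AE AE_I2 dented_bump_nonneg)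
  have "(LINT x|M. ?h x) * norm (\<Phi> y) = norm (LINT x|M. complex_of_real (?h x) * (\<Phi> x - \<Phi> y))"
    unfolding eq using nn by (simp add: norm_mult)
  also have "\<dots> \<le> (LINT x|M. norm (complex_of_real (?h x) * (\<Phi> x - \<Phi> y)))"
    by (rule integral_norm_bound)
  also have "\<dots> \<le> (LINT x|M. ?h x * (norm (\<Phi> y) / 2))"
    using near dented_bump_nonneg[of e y d]
    by (intro integral_mono integrable_norm int1 integrable_mult_left int) (simp add: norm_mult)
  also have "\<dots> = (LINT x|M. ?h x) * (norm (\<Phi> y) / 2)" by simp
  \<comment> \<open>Since \<Phi> differs from its value at \<open>y\<close> by at most half of that
    value on the support, the integral of the bump times the norm of \<open>\<Phi> y\<close> is at
    most half of itself.\<close>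
  finally have "(LINT x|M. ?h x) * norm (\<Phi> y) \<le> 0" by (simp add: mult.commute)
  then have "(LINT x|M. ?h x) = 0" using nn nz by (auto simp: mult_le_0_iff)
  then have "AE x in M. ?h x = 0"
    using integral_nonneg_eq_0_iff_AE[OF int] dented_bump_nonneg[of e y d] by simp
  moreover have "y + (d / 2) *\<^sub>R e \<in> \<Omega>" using r(2) d e by (auto simp: dist_norm intro!: subsetD[OF r(2)])
  ultimately have "?h (y + (d / 2) *\<^sub>R e) = 0" using AE_zero_continuous contd by blast
  then show False using dented_bump_pos[OF d(1) e, of y] by simp
qed

subsection \<open>Resolvent data of test functions\<close>

text \<open>Substituting \<kappa> \<phi> into the equation leaves (\<kappa> - 1) times the Laplacian
  of \<phi> plus a multiple of \<phi> equal to 0. At the centre \<phi> vanishes and its Laplacian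
  does not.\<close>

lemma dirichlet_realization_multiple_eq_1:
  assumes e: "e \<in> Basis" and d: "d > 0" "cball y d \<subseteq> \<Omega>"
    and p: "continuous_on UNIV p" and p1: "continuous_on UNIV p1"
    and \<phi>_def: "\<phi> = (\<lambda>x. complex_of_real (dented_bump e y d x))"
    and f_def: "f = (\<lambda>x. - laplacian \<phi> x + complex_of_real (p1 x) * \<phi> x)"
    and dr: "dirichlet_realization \<Omega> p u f" and ae: "AE x in M. u x = \<kappa> * \<phi> x"
  shows "\<kappa> = 1"
proof -
  define \<Phi> where "\<Phi> x = (\<kappa> - 1) * laplacian \<phi> x + (complex_of_real (p1 x) - \<kappa> * complex_of_real (p x)) * \<phi> x" for x
  have \<phi>: "\<phi> \<in> test_functions \<Omega>" unfolding \<phi>_def by (rule dented_bump_test[OF d])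
  note sm = test_functions_smooth[OF \<phi>]
  obtain g where g: "weak_laplacian \<Omega> u g" and fg: "AE x in M. f x = - g x + complex_of_real (p x) * u x"
    using dr unfolding dirichlet_realization_def by blast
  have L2: "u \<in> L2 \<Omega>" "g \<in> L2 \<Omega>" using g by (auto simp: weak_laplacian_def)
  have cont: "continuous_on UNIV \<phi>" "continuous_on UNIV (laplacian \<phi>)"
    by (intro smooth_on_continuous laplacian_smooth sm)+
  have cont\<Phi>: "continuous_on UNIV \<Phi>"
    unfolding \<Phi>_def[abs_def] by (intro continuous_intros cont p p1)
  \<comment> \<open>The solution \<open>u\<close> is known only almost everywhere, so the identity
    is first obtained weakly. Continuity of \<Phi> then allows evaluation at \<open>y\<close> by
    concentrating dented bumps.\<close>
  have *: "(LINT x|M. \<psi> x * \<Phi> x) = 0" if \<psi>: "\<psi> \<in> test_functions \<Omega>" for \<psi>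
  proof -
    note i = L2_mult_integrable[OF _ test_functions_L2[OF \<psi>]]
    have c\<psi>: "continuous_on UNIV \<psi>" by (rule test_functions_continuous[OF \<psi>])
    have "(LINT x|M. g x * \<psi> x) = (LINT x|M. u x * laplacian \<psi> x)"
      using g \<psi> by (simp add: weak_laplacian_def)
    also have "\<dots> = (LINT x|M. \<kappa> * (\<phi> x * laplacian \<psi> x))"
    proof (rule integral_cong_AE)
      show "AE x in M. u x * laplacian \<psi> x = \<kappa> * (\<phi> x * laplacian \<psi> x)"
        using ae by eventually_elim simp
      show "(\<lambda>x. u x * laplacian \<psi> x) \<in> borel_measurable M"
        using L2_mult_integrable[OF L2(1) test_functions_L2[OF test_functions_laplacian[OF \<psi>]]] by simp
      show "(\<lambda>x. \<kappa> * (\<phi> x * laplacian \<psi> x)) \<in> borel_measurable M"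
        by (intro continuous_measurable continuous_intros cont smooth_on_continuous laplacian_smooth test_functions_smooth[OF \<psi>])
    qed
    also have "\<dots> = \<kappa> * (LINT x|M. laplacian \<phi> x * \<psi> x)"
      by (simp add: integration_by_parts_laplacian[OF sm \<psi>])
    finally have "(LINT x|M. g x * \<psi> x) - \<kappa> * (LINT x|M. laplacian \<phi> x * \<psi> x) = 0" by simp
    then have "(LINT x|M. \<kappa> * (laplacian \<phi> x * \<psi> x) - g x * \<psi> x) = 0"
      using i[OF L2(2)] i[OF continuous_L2[OF cont(2)]] by simp
    moreover have "(LINT x|M. \<kappa> * (laplacian \<phi> x * \<psi> x) - g x * \<psi> x) = (LINT x|M. \<psi> x * \<Phi> x)"
    proof (rule integral_cong_AE)
      show "AE x in M. \<kappa> * (laplacian \<phi> x * \<psi> x) - g x * \<psi> x = \<psi> x * \<Phi> x"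
        using fg ae
      proof eventually_elim
        case (elim x)
        then have gx: "g x = complex_of_real (p x) * (\<kappa> * \<phi> x) + laplacian \<phi> x - complex_of_real (p1 x) * \<phi> x"
          unfolding f_def by (simp add: algebra_simps)
        show ?case unfolding \<Phi>_def gx by (simp add: algebra_simps)
      qed
      show "(\<lambda>x. \<kappa> * (laplacian \<phi> x * \<psi> x) - g x * \<psi> x) \<in> borel_measurable M"
        using i[OF L2(2)] i[OF continuous_L2[OF cont(2)]] by simp
      show "(\<lambda>x. \<psi> x * \<Phi> x) \<in> borel_measurable M"
        by (intro continuous_measurable continuous_on_mult c\<psi> cont\<Phi>)
    qed
    ultimately show ?thesis by simp
  qed
  have "\<Phi> y = 0"
  proof (rule eq_0_if_integral_dented_bump_eq_0[OF e d])
    show "isCont \<Phi> y" using cont\<Phi> by (simp add: continuous_on_eq_continuous_at)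
    fix d' assume "0 < d'" "d' \<le> d"
    then show "(LINT x|M. complex_of_real (dented_bump e y d' x) * \<Phi> x) = 0"
      using d by (intro * dented_bump_test) auto
  qed (rule continuous_measurable[OF cont\<Phi>])
  moreover have "laplacian \<phi> y = complex_of_real (2 * bump y d y)"
    unfolding \<phi>_def by (simp only: laplacian_of_real smooth_on_dented_bump laplacian_dented_bump_center[OF e])
  moreover have "\<phi> y = 0" by (simp add: \<phi>_def)
  moreover have "bump y d y > 0" using d by (simp add: bump_pos_iff)
  ultimately show ?thesis by (simp add: \<Phi>_def)
qed

section \<open>The solution operator as a choice of representative\<close>

lemma dirichlet_inverse_AE:
  assumes "continuous_on UNIV p" "\<forall>x\<in>\<Omega>. p x \<ge> 0" "dirichlet_realization \<Omega> p v f"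
  shows "dirichlet_realization \<Omega> p (dirichlet_inverse \<Omega> p f) f" "AE x in M. dirichlet_inverse \<Omega> p f x = v x"
proof -
  show *: "dirichlet_realization \<Omega> p (dirichlet_inverse \<Omega> p f) f"
    unfolding dirichlet_inverse_def by (rule someI[of "\<lambda>u. dirichlet_realization \<Omega> p u f", OF assms(3)])
  show "AE x in M. dirichlet_inverse \<Omega> p f x = v x"
    by (rule dirichlet_realization_unique[OF assms(1,2) * assms(3)])
qed

lemma dirichlet_realization_scale:
  assumes "dirichlet_realization \<Omega> p u f"
  shows "dirichlet_realization \<Omega> p (\<lambda>x. c * u x) (\<lambda>x. c * f x)"
  using dirichlet_realization_lincomb[OF assms assms, of c 0] by simp

text \<open>Genuine solutions scale with the right-hand side; this distinguishes them from the
  default value of the choice operator.\<close>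

lemma dirichlet_inverse_double:
  assumes "continuous_on UNIV p" "\<forall>x\<in>\<Omega>. p x \<ge> 0" "dirichlet_realization \<Omega> p v f"
  shows "AE x in M. dirichlet_inverse \<Omega> p (\<lambda>x. 2 * f x) x = 2 * dirichlet_inverse \<Omega> p f x"
  by (rule dirichlet_inverse_AE(2)[OF assms(1,2)])
    (auto intro: dirichlet_realization_scale dirichlet_inverse_AE(1)[OF assms])

text \<open>Halving a solution for \<open>2 f\<close> would give one for \<open>f\<close>, so both
  right-hand sides are unsolvable together. Both choices then range over the same empty predicate
  and return the same function.\<close>

lemma dirichlet_inverse_junk:
  assumes "\<nexists>u. dirichlet_realization \<Omega> p u f"
  shows "dirichlet_inverse \<Omega> p f = (SOME u. False)" "dirichlet_inverse \<Omega> p (\<lambda>x. 2 * f x) = (SOME u. False)"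
proof -
  show "dirichlet_inverse \<Omega> p f = (SOME u. False)" using assms by (simp add: dirichlet_inverse_def)
  have "\<not> dirichlet_realization \<Omega> p u (\<lambda>x. 2 * f x)" for u
  proof
    assume "dirichlet_realization \<Omega> p u (\<lambda>x. 2 * f x)"
    from dirichlet_realization_scale[OF this, of "1 / 2"] show False using assms by auto
  qed
  then show "dirichlet_inverse \<Omega> p (\<lambda>x. 2 * f x) = (SOME u. False)" by (simp add: dirichlet_inverse_def)
qed

text \<open>Solvability for all square integrable right-hand sides would need the completeness of \<open>H10\<close>. Here
  it is not needed: where no solution exists, \<open>dirichlet_inverse\<close> has a fixed junk value, and
  comparing the assumed identity at \<open>f\<close> and at \<open>2 f\<close> shows that a multiple of \<open>\<phi>\<close> other than \<open>\<phi>\<close>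
  itself solves the equation for \<open>f\<close>.\<close>

lemma dirichlet_realization_solvable:
  fixes \<tau> :: real
  assumes e: "e \<in> Basis" and d: "d > 0" "cball y d \<subseteq> \<Omega>"
    and cont: "continuous_on UNIV q" "continuous_on UNIV q1" "continuous_on UNIV q2"
    and pos: "\<forall>x\<in>\<Omega>. q x \<ge> 0" "\<forall>x\<in>\<Omega>. q1 x \<ge> 0" "\<forall>x\<in>\<Omega>. q2 x \<ge> 0"
    and \<tau>: "0 < \<tau>" "\<tau> < 1"
    and conv: "\<And>f. f \<in> L2 \<Omega> \<Longrightarrow> AE x in M. dirichlet_inverse \<Omega> q f x =
      complex_of_real \<tau> * dirichlet_inverse \<Omega> q1 f x + complex_of_real (1 - \<tau>) * dirichlet_inverse \<Omega> q2 f x"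
    and \<phi>_def: "\<phi> = (\<lambda>x. complex_of_real (dented_bump e y d x))"
    and f_def: "f = (\<lambda>x. - laplacian \<phi> x + complex_of_real (q1 x) * \<phi> x)"
  obtains u u2 where "dirichlet_realization \<Omega> q u f" "dirichlet_realization \<Omega> q2 u2 f"
    "AE x in M. u x = complex_of_real \<tau> * \<phi> x + complex_of_real (1 - \<tau>) * u2 x"
proof -
  let ?G = "dirichlet_inverse \<Omega>" and ?f2 = "\<lambda>x. 2 * f x"
  define t where "t = complex_of_real \<tau>"
  have t: "complex_of_real (1 - \<tau>) = 1 - t" "t \<noteq> 0" "1 - t \<noteq> 0" "t \<noteq> 1"
    using \<tau> by (auto simp: t_def)
  note mult1 = dirichlet_realization_multiple_eq_1[OF e d _ cont(2) \<phi>_def f_def]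
  have \<phi>: "\<phi> \<in> test_functions \<Omega>" unfolding \<phi>_def by (rule dented_bump_test[OF d])
  have dr1: "dirichlet_realization \<Omega> q1 \<phi> f"
    unfolding f_def by (rule dirichlet_realization_test[OF \<phi> cont(2)])
  then have f: "f \<in> L2 \<Omega>" by (simp add: dirichlet_realization_def)
  note G1 = dirichlet_inverse_AE(2)[OF cont(2) pos(2) dr1]
  have eq1: "AE x in M. ?G q f x = t * \<phi> x + (1 - t) * ?G q2 f x"
    using conv[OF f] G1 by eventually_elim (simp add: t_def)
  have eq2: "AE x in M. ?G q ?f2 x = 2 * t * \<phi> x + (1 - t) * ?G q2 ?f2 x"
    using conv[OF L2_cmult[OF f, of 2]] G1 dirichlet_inverse_double[OF cont(2) pos(2) dr1]
    by eventually_elim (simp add: t_def)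
  show thesis
  proof (cases "\<exists>u. dirichlet_realization \<Omega> q u f"; cases "\<exists>u. dirichlet_realization \<Omega> q2 u f")
    assume "\<exists>u. dirichlet_realization \<Omega> q u f" "\<exists>u. dirichlet_realization \<Omega> q2 u f"
    then obtain u v where "dirichlet_realization \<Omega> q u f" "dirichlet_realization \<Omega> q2 v f" by blast
    then show thesis
      using that dirichlet_inverse_AE(1)[OF cont(1) pos(1)] dirichlet_inverse_AE(1)[OF cont(3) pos(3)] eq1
      unfolding t(1) t_def[symmetric] by blast
  next
    assume "\<exists>u. dirichlet_realization \<Omega> q u f" and no: "\<nexists>u. dirichlet_realization \<Omega> q2 u f"
    then obtain u where u: "dirichlet_realization \<Omega> q u f" by blast
    note junk = dirichlet_inverse_junk[OF no]
    have "AE x in M. ?G q f x = t * \<phi> x"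
      using eq1 eq2 dirichlet_inverse_double[OF cont(1) pos(1) u]
    proof eventually_elim
      case (elim x)
      \<comment> \<open>Here \<open>d\<close> is the contribution of the default value, unchanged
        between \<open>f\<close> and \<open>2 f\<close>, while \<open>a\<close> and \<open>c\<close>
        double; hence \<open>d\<close> is 0. The solution for \<open>q\<close> is then t \<phi> with
        \<open>t\<close> different from 1, a contradiction.\<close>
      have "a = c" if "a = c + d" "b = 2 * c + d" "b = 2 * a" for a b c d :: complex
        using that by simp
      from this[OF elim(1)[unfolded junk] elim(2)[unfolded junk mult.assoc] elim(3)] show ?case .
    qed
    from mult1[OF cont(1) dirichlet_inverse_AE(1)[OF cont(1) pos(1) u] this] t show thesis by simp
  next
    assume no: "\<nexists>u. dirichlet_realization \<Omega> q u f" and "\<exists>u. dirichlet_realization \<Omega> q2 u f"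
    then obtain u where u: "dirichlet_realization \<Omega> q2 u f" by blast
    note junk = dirichlet_inverse_junk[OF no]
    \<comment> \<open>Now the left-hand side is the unchanged default value while the right-hand
      side doubles, so the right-hand side is 0. The resulting factor - t / (1 - t) is never
      1.\<close>
    have "AE x in M. ?G q2 f x = (- t / (1 - t)) * \<phi> x"
      using eq1 eq2 dirichlet_inverse_double[OF cont(3) pos(3) u]
    proof eventually_elim
      case (elim x)
      then have "t * \<phi> x + (1 - t) * ?G q2 f x = 2 * (t * \<phi> x + (1 - t) * ?G q2 f x)"
        unfolding junk by (simp add: algebra_simps)
      moreover have "z = 0" if "z = 2 * z" for z :: complex using that by simp
      ultimately have "t * \<phi> x + (1 - t) * ?G q2 f x = 0" by blast
      then show ?case using t by (simp add: field_simps eq_neg_iff_add_eq_0)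
    qed
    from mult1[OF cont(3) dirichlet_inverse_AE(1)[OF cont(3) pos(3) u] this] t show thesis
      by (simp add: field_simps)
  next
    assume no: "\<nexists>u. dirichlet_realization \<Omega> q u f" "\<nexists>u. dirichlet_realization \<Omega> q2 u f"
    \<comment> \<open>Both default values cancel between \<open>f\<close> and \<open>2 f\<close>,
      leaving \<phi> = 0 almost everywhere. Writing this as the multiple with factor 0 brings it
      under the same contradiction, now for \<open>q1\<close>.\<close>
    have "AE x in M. \<phi> x = 0 * \<phi> x"
      using eq1 eq2
    proof eventually_elim
      case (elim x)
      then have "t * \<phi> x = 2 * (t * \<phi> x)"
        unfolding dirichlet_inverse_junk[OF no(1)] dirichlet_inverse_junk[OF no(2)]
        by (metis add_right_cancel mult.assoc)
      then show ?case using t by simp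
    qed
    from mult1[OF cont(2) dr1 this] show thesis by simp
  qed
qed

text \<open>An element of \<open>H10\<close> is a limit of test functions, so a vanishing distribution built from it can be
  tested against approximations of itself.\<close>

lemma potentials_relation:
  fixes \<tau> :: real
  assumes smooth: "smooth_on UNIV q" "smooth_on UNIV q1" "smooth_on UNIV q2"
    and \<phi>: "\<phi> \<in> test_functions \<Omega>"
    and f_def: "f = (\<lambda>x. - laplacian \<phi> x + complex_of_real (q1 x) * \<phi> x)"
    and dr: "dirichlet_realization \<Omega> q u f" and dr2: "dirichlet_realization \<Omega> q2 u2 f"
    and ae: "AE x in M. u x = complex_of_real \<tau> * \<phi> x + complex_of_real (1 - \<tau>) * u2 x"
  shows "AE x in M. complex_of_real (\<tau> * (q x - q1 x)) * \<phi> x + complex_of_real ((1 - \<tau>) * (q x - q2 x)) * u2 x = 0"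
proof -
  define a where "a x = complex_of_real (\<tau> * (q x - q1 x))" for x
  define b where "b x = complex_of_real ((1 - \<tau>) * (q x - q2 x))" for x
  define F where "F x = a x * \<phi> x + b x * u2 x" for x
  have sub: "smooth_on UNIV (\<lambda>x. complex_of_real (c * (g x - h x)))"
    if "smooth_on UNIV g" "smooth_on UNIV h" for c and g h :: "'a \<Rightarrow> real"
  proof -
    have "smooth_on UNIV (\<lambda>x. c * (g x + (- 1) * h x))"
      by (intro smooth_on_mult smooth_on_add smooth_on_const that)
    then show ?thesis by (intro bounded_linear.smooth_on_compose[OF bounded_linear_of_real]) simp
  qed
  have ab: "smooth_on UNIV a" "smooth_on UNIV b"
    unfolding a_def[abs_def] b_def[abs_def] by (intro sub smooth)+
  obtain g where g: "weak_laplacian \<Omega> u g" and fg: "AE x in M. f x = - g x + complex_of_real (q x) * u x"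
    using dr unfolding dirichlet_realization_def by blast
  obtain g2 where g2: "weak_laplacian \<Omega> u2 g2" and fg2: "AE x in M. f x = - g2 x + complex_of_real (q2 x) * u2 x"
    using dr2 unfolding dirichlet_realization_def by blast
  have L2: "u \<in> L2 \<Omega>" "g \<in> L2 \<Omega>" "u2 \<in> L2 \<Omega>" "g2 \<in> L2 \<Omega>"
    using g g2 by (auto simp: weak_laplacian_def)
  note L2\<phi> = test_functions_L2[OF \<phi>]
  have L2F: "F \<in> L2 \<Omega>"
    unfolding F_def[abs_def] by (intro L2_add L2_mult_continuous L2 L2\<phi> smooth_on_continuous ab)
  \<comment> \<open>This is the difference of two weak Laplacians of the same function, one from
    \<open>u\<close> and one from the combination of \<phi> and \<open>u2\<close>. Inserting the
    three equations cancels \<open>f\<close>, as the weights add up to 1, and leaves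
    \<open>F\<close>.\<close>
  let ?w = "\<lambda>x. 1 * g x + (- 1) * (complex_of_real \<tau> * laplacian \<phi> x + complex_of_real (1 - \<tau>) * g2 x)"
  let ?v = "\<lambda>x. complex_of_real \<tau> * laplacian \<phi> x + complex_of_real (1 - \<tau>) * g2 x"
  have wl: "weak_laplacian \<Omega> (\<lambda>x. complex_of_real \<tau> * \<phi> x + complex_of_real (1 - \<tau>) * u2 x) ?v"
    by (rule weak_laplacian_lincomb[OF weak_laplacian_test[OF \<phi>] g2])
  then have L2v: "?v \<in> L2 \<Omega>" by (simp add: weak_laplacian_def)
  have wF: "AE x in M. ?w x = F x"
    using fg fg2 ae
  proof eventually_elim
    case (elim x)
    have gx: "g x = complex_of_real (q x) * u x - f x" by (subst elim(1)) simp
    have g2x: "g2 x = complex_of_real (q2 x) * u2 x - f x" by (subst elim(2)) simp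
    show ?case
      unfolding gx g2x F_def a_def b_def f_def elim(3) by (simp add: algebra_simps)
  qed
  have zero: "(LINT x|M. F x * \<psi> x) = 0" if \<psi>: "\<psi> \<in> test_functions \<Omega>" for \<psi>
  proof -
    note L2\<psi> = test_functions_L2[OF \<psi>]
    note L2\<Delta> = test_functions_L2[OF test_functions_laplacian[OF \<psi>]]
    have "(LINT x|M. g x * \<psi> x) = (LINT x|M. u x * laplacian \<psi> x)"
      using g \<psi> by (simp add: weak_laplacian_def)
    also have "\<dots> = (LINT x|M. (complex_of_real \<tau> * \<phi> x + complex_of_real (1 - \<tau>) * u2 x) * laplacian \<psi> x)"
    proof (rule integral_cong_AE)
      show "AE x in M. u x * laplacian \<psi> x =
          (complex_of_real \<tau> * \<phi> x + complex_of_real (1 - \<tau>) * u2 x) * laplacian \<psi> x"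
        using ae by eventually_elim simp
      show "(\<lambda>x. u x * laplacian \<psi> x) \<in> borel_measurable M"
        using L2_mult_integrable[OF L2(1) L2\<Delta>] by simp
      show "(\<lambda>x. (complex_of_real \<tau> * \<phi> x + complex_of_real (1 - \<tau>) * u2 x) * laplacian \<psi> x) \<in> borel_measurable M"
        using wl L2_mult_integrable[OF _ L2\<Delta>] by (auto simp: weak_laplacian_def)
    qed
    also have "\<dots> = (LINT x|M. ?v x * \<psi> x)"
      using wl \<psi> by (simp add: weak_laplacian_def)
    finally have "(LINT x|M. ?w x * \<psi> x) = 0"
      unfolding integral_lincomb[OF L2(2) L2v L2\<psi>] by simp
    moreover have "(LINT x|M. ?w x * \<psi> x) = (LINT x|M. F x * \<psi> x)"
    proof (rule integral_cong_AE)
      show "AE x in M. ?w x * \<psi> x = F x * \<psi> x" using wF by eventually_elim simp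
      have "?w \<in> L2 \<Omega>" by (intro L2_add L2_cmult L2 L2v)
      from L2_mult_integrable[OF this L2\<psi>] show "(\<lambda>x. ?w x * \<psi> x) \<in> borel_measurable M" by simp
      show "(\<lambda>x. F x * \<psi> x) \<in> borel_measurable M" using L2_mult_integrable[OF L2F L2\<psi>] by simp
    qed
    ultimately show ?thesis by simp
  qed
  obtain \<theta> where \<theta>: "\<And>k::nat. \<theta> k \<in> test_functions \<Omega>" and lim: "(\<lambda>k. L2_norm \<Omega> (\<lambda>x. \<theta> k x - u2 x)) \<longlonglongrightarrow> 0"
    using dr2 unfolding dirichlet_realization_def H10_def by blast
  \<comment> \<open>Smoothness of \<open>a\<close> and \<open>b\<close> keeps these approximations
    of \<open>F\<close> inside the test functions, so \<open>F\<close> annihilates their conjugates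
    and, in the limit, its own.\<close>
  let ?F = "\<lambda>k x. a x * \<phi> x + b x * \<theta> k x"
  have F: "?F k \<in> test_functions \<Omega>" for k
    by (intro test_functions_add test_functions_mult ab \<phi> \<theta>)
  have "(\<lambda>k. L2_norm \<Omega> (\<lambda>x. ?F k x - F x)) \<longlonglongrightarrow> 0"
    unfolding F_def
    by (rule L2_limit_lincomb[where v = "\<lambda>_. \<phi>"])
      (use lim in \<open>auto intro: L2 L2\<phi> test_functions_L2[OF \<theta>] smooth_on_continuous ab simp: L2_norm_def\<close>)
  from L2_limit_integral_cnj[OF test_functions_L2[OF F] L2F L2F this]
  have "(\<lambda>k. LINT x|M. F x * cnj (?F k x)) \<longlonglongrightarrow> (LINT x|M. F x * cnj (F x))" .
  moreover have "(LINT x|M. F x * cnj (?F k x)) = 0" for k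
    by (rule zero[OF test_functions_cnj[OF F]])
  ultimately have "(LINT x|M. F x * cnj (F x)) = 0" by (simp add: LIMSEQ_const_iff)
  then have "(LINT x|M. (norm (F x))\<^sup>2) = 0"
    by (simp add: mult_cnj_norm del: of_real_power)
  from norm_sq_integral_eq_0[OF L2F this] show ?thesis by (simp add: F_def a_def b_def)
qed

subsection \<open>Convex combinations of solution operators\<close>

text \<open>The right-hand sides are built from \<open>q1\<close>, which makes the solution for
  \<open>q1\<close> explicit and leaves a conclusion about \<open>q2\<close>. The statement for
  \<open>q1\<close> comes from exchanging the two potentials and replacing \<tau> by 1 -
  \<tau>.\<close>

lemma convex_combination_potential_eq:
  fixes \<tau> :: real
  assumes smooth: "smooth_on UNIV q" "smooth_on UNIV q1" "smooth_on UNIV q2"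
    and pos: "\<forall>x\<in>\<Omega>. q x \<ge> 0" "\<forall>x\<in>\<Omega>. q1 x \<ge> 0" "\<forall>x\<in>\<Omega>. q2 x \<ge> 0"
    and \<tau>: "0 < \<tau>" "\<tau> < 1"
    and conv: "\<And>f. f \<in> L2 \<Omega> \<Longrightarrow> AE x in M. dirichlet_inverse \<Omega> q f x =
      complex_of_real \<tau> * dirichlet_inverse \<Omega> q1 f x + complex_of_real (1 - \<tau>) * dirichlet_inverse \<Omega> q2 f x"
    and y: "y \<in> \<Omega>"
  shows "q y = q2 y"
proof (rule ccontr)
  assume neq: "q y \<noteq> q2 y"
  note cont = smooth_on_continuous[OF smooth(1)] smooth_on_continuous[OF smooth(2)] smooth_on_continuous[OF smooth(3)]
  have "open (\<Omega> \<inter> {x. q x \<noteq> q2 x})"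
    by (intro open_Int open_set open_Collect_neq cont)
  then obtain r where r: "r > 0" "cball y r \<subseteq> \<Omega> \<inter> {x. q x \<noteq> q2 x}"
    using y neq open_contains_cball by blast
  then have r\<Omega>: "cball y r \<subseteq> \<Omega>" and rb: "\<And>x. x \<in> cball y r \<Longrightarrow> q x \<noteq> q2 x" by auto
  obtain e :: 'a where e: "e \<in> Basis" using nonempty_Basis by blast
  \<comment> \<open>Division by zero makes \<open>c\<close> total and measurable on \<Omega>. Its
    values where \<open>q\<close> and \<open>q2\<close> agree do not enter, as the functions \<psi>
    below are supported in the ball where they differ.\<close>
  define c where "c x = complex_of_real (- (\<tau> * (q x - q1 x)) / ((1 - \<tau>) * (q x - q2 x)))" for x
  have c_meas: "c \<in> borel_measurable M"
  proof -
    have "(\<lambda>x. - (\<tau> * (q x - q1 x))) \<in> borel_measurable M" "(\<lambda>x. (1 - \<tau>) * (q x - q2 x)) \<in> borel_measurable M"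
      by (intro continuous_measurable continuous_intros cont)+
    from measurable_compose[OF borel_measurable_divide[OF this]
        borel_measurable_continuous_onI[OF continuous_on_of_real_id]]
    show ?thesis unfolding c_def[abs_def] .
  qed
  have q_cont: "isCont q y" "isCont q1 y" "isCont q2 y"
    using cont[of UNIV] by (simp_all add: continuous_on_eq_continuous_at)
  with neq \<tau> have c_cont: "isCont c y"
    unfolding c_def[abs_def] by (intro continuous_intros) auto
  \<comment> \<open>The factor \<open>c\<close> depends on the potentials alone and not on the
    radius of the bump \<phi>. Hence \<psi> can be fixed and the same bracket tested against dented
    bumps of every small radius.\<close>
  have key: "(c y - 1) * laplacian \<psi> y = (complex_of_real (q2 y) * c y - complex_of_real (q1 y)) * \<psi> y"
    if \<psi>r: "\<psi> \<in> test_functions (cball y r)" for \<psi>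
  proof -
    have \<psi>: "\<psi> \<in> test_functions \<Omega>" using \<psi>r r\<Omega> by (auto simp: test_functions_def)
    have out: "\<psi> x = 0" "laplacian \<psi> x = 0" if "x \<notin> cball y r" for x
      using test_functions_outside[OF \<psi>r that] test_functions_outside[OF test_functions_laplacian[OF \<psi>r] that]
      by auto
    define \<Phi> where "\<Phi> x = (c x - 1) * laplacian \<psi> x - (complex_of_real (q2 x) * c x - complex_of_real (q1 x)) * \<psi> x" for x
    have cont\<psi>: "continuous_on UNIV \<psi>" "continuous_on UNIV (laplacian \<psi>)"
      by (rule test_functions_continuous[OF \<psi>] test_functions_continuous[OF test_functions_laplacian[OF \<psi>]])+
    have contq: "continuous_on UNIV (\<lambda>x. complex_of_real (q1 x))" "continuous_on UNIV (\<lambda>x. complex_of_real (q2 x))"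
      by (intro continuous_intros cont)+
    have \<Phi>_meas: "\<Phi> \<in> borel_measurable M"
      unfolding \<Phi>_def[abs_def]
      using c_meas continuous_measurable[OF cont\<psi>(1)] continuous_measurable[OF cont\<psi>(2)]
        continuous_measurable[OF contq(1)] continuous_measurable[OF contq(2)] by simp
    have "\<Phi> y = 0"
    proof (rule eq_0_if_integral_dented_bump_eq_0[OF e r(1) r\<Omega> \<Phi>_meas])
      have "isCont \<psi> y" "isCont (laplacian \<psi>) y"
        using cont\<psi> by (simp_all add: continuous_on_eq_continuous_at)
      then show "isCont \<Phi> y" unfolding \<Phi>_def[abs_def] using c_cont q_cont by (intro continuous_intros)
    next
      fix d assume d: "0 < d" "d \<le> r"
      then have d\<Omega>: "cball y d \<subseteq> \<Omega>" using r\<Omega> by auto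
      define \<phi> where "\<phi> = (\<lambda>x. complex_of_real (dented_bump e y d x))"
      define f where "f = (\<lambda>x. - laplacian \<phi> x + complex_of_real (q1 x) * \<phi> x)"
      have \<phi>: "\<phi> \<in> test_functions \<Omega>" unfolding \<phi>_def by (rule dented_bump_test[OF d(1) d\<Omega>])
      obtain u u2 where dr: "dirichlet_realization \<Omega> q u f" and dr2: "dirichlet_realization \<Omega> q2 u2 f"
        and ae: "AE x in M. u x = complex_of_real \<tau> * \<phi> x + complex_of_real (1 - \<tau>) * u2 x"
        using dirichlet_realization_solvable[OF e d(1) d\<Omega> cont pos \<tau> conv \<phi>_def f_def] by blast
      obtain g where g: "weak_laplacian \<Omega> u2 g" and fg: "AE x in M. f x = - g x + complex_of_real (q2 x) * u2 x"
        using dr2 unfolding dirichlet_realization_def by blast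
      have L2: "u2 \<in> L2 \<Omega>" "g \<in> L2 \<Omega>" using g by (auto simp: weak_laplacian_def)
      note L2\<psi> = test_functions_L2[OF \<psi>] test_functions_L2[OF test_functions_laplacian[OF \<psi>]]
      note L2\<phi> = test_functions_L2[OF \<phi>] test_functions_L2[OF test_functions_laplacian[OF \<phi>]]
      note int = L2_mult_integrable[OF L2(1) L2\<psi>(2)] L2_mult_integrable[OF L2\<phi>(1) L2\<psi>(2)]
        L2_mult_integrable[OF L2(2) L2\<psi>(1)] L2_mult_integrable[OF L2\<phi>(2) L2\<psi>(1)]
      \<comment> \<open>Inside the ball this uses u2 = c \<phi> and the equation for
        \<open>u2\<close>; outside, every term has a factor \<psi> or its Laplacian. The right-hand
        side vanishes since \<open>g\<close> and the Laplacian of \<phi> are the weak Laplacians of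
        \<open>u2\<close> and \<phi>.\<close>
      have "(LINT x|M. \<phi> x * \<Phi> x) =
        (LINT x|M. u2 x * laplacian \<psi> x - \<phi> x * laplacian \<psi> x - (g x * \<psi> x - laplacian \<phi> x * \<psi> x))"
      proof (rule integral_cong_AE)
        show "AE x in M. \<phi> x * \<Phi> x =
            u2 x * laplacian \<psi> x - \<phi> x * laplacian \<psi> x - (g x * \<psi> x - laplacian \<phi> x * \<psi> x)"
          using fg potentials_relation[OF smooth \<phi> f_def dr dr2 ae]
        proof eventually_elim
          case (elim x)
          show ?case
          proof (cases "x \<in> cball y r")
            case True
            define b where "b = complex_of_real ((1 - \<tau>) * (q x - q2 x))"
            have solve: "v = z * w" if "b' \<noteq> 0" "a' * w + b' * v = 0" "z = - a' / b'" for a' b' v w z :: complex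
            proof -
              have "z * b' = - a'" using that(1,3) by simp
              then have "b' * v = b' * (z * w)" using that(2) by algebra
              then show ?thesis using that(1) by simp
            qed
            have "b \<noteq> 0" using rb[OF True] \<tau> by (simp add: b_def)
            moreover have "complex_of_real (\<tau> * (q x - q1 x)) * \<phi> x + b * u2 x = 0"
              using elim(2) by (simp only: b_def)
            moreover have "c x = - complex_of_real (\<tau> * (q x - q1 x)) / b"
              by (simp only: c_def b_def of_real_divide of_real_minus)
            ultimately have u2: "u2 x = c x * \<phi> x" by (rule solve)
            have "g x = complex_of_real (q2 x) * u2 x - f x" by (subst elim(1)) simp
            then have gx: "g x = complex_of_real (q2 x) * (c x * \<phi> x) + laplacian \<phi> x - complex_of_real (q1 x) * \<phi> x"
              unfolding f_def u2 by simp
            show ?thesis unfolding \<Phi>_def gx u2 by (simp add: algebra_simps)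
          next
            case False
            then show ?thesis by (simp add: \<Phi>_def out)
          qed
        qed
        show "(\<lambda>x. \<phi> x * \<Phi> x) \<in> borel_measurable M" using L2_measurable[OF L2\<phi>(1)] \<Phi>_meas by simp
        show "(\<lambda>x. u2 x * laplacian \<psi> x - \<phi> x * laplacian \<psi> x - (g x * \<psi> x - laplacian \<phi> x * \<psi> x)) \<in> borel_measurable M"
          using int by simp
      qed
      also have "\<dots> = (LINT x|M. u2 x * laplacian \<psi> x) - (LINT x|M. \<phi> x * laplacian \<psi> x)
          - ((LINT x|M. g x * \<psi> x) - (LINT x|M. laplacian \<phi> x * \<psi> x))"
        using int by simp
      also have "\<dots> = 0"
        using g \<psi> integration_by_parts_laplacian[OF test_functions_smooth[OF \<phi>] \<psi>]
        by (simp add: weak_laplacian_def)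
      finally show "(LINT x|M. complex_of_real (dented_bump e y d x) * \<Phi> x) = 0"
        by (simp add: \<phi>_def)
    qed
    then show ?thesis by (simp add: \<Phi>_def)
  qed
  have bump: "bump y r y > 0" using r(1) by (simp add: bump_pos_iff)
  \<comment> \<open>The dented bump removes the term with \<psi> at \<open>y\<close>. Afterwards the
    plain bump, positive at \<open>y\<close>, isolates the potentials.\<close>
  have "(c y - 1) * complex_of_real (2 * bump y r y) = 0"
    using key[OF dented_bump_test[OF r(1) order_refl, of e]]
    by (simp only: laplacian_of_real smooth_on_dented_bump laplacian_dented_bump_center[OF e]) simp
  then have c1: "c y = 1" using bump by simp
  then have "complex_of_real (q2 y) - complex_of_real (q1 y) = 0"
    using key[OF bump_test[OF r(1) order_refl]] bump by simp
  then have q12: "q1 y = q2 y" by simp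
  have "- (\<tau> * (q y - q1 y)) / ((1 - \<tau>) * (q y - q2 y)) = 1"
    using c1 unfolding c_def by (metis of_real_eq_1_iff)
  then have "- (\<tau> * (q y - q1 y)) = (1 - \<tau>) * (q y - q2 y)"
    by (simp only: divide_eq_1_iff)
  then have "q y = q2 y" unfolding q12 by (simp add: algebra_simps)
  with neq show False ..
qed

end

text \<open>The two realizations coincide as predicates, so the choice returns literally the same
  function. This permits replacing each potential by a smooth extension to the whole space.\<close>

lemma dirichlet_inverse_cong:
  assumes "open \<Omega>" "\<And>x. x \<in> \<Omega> \<Longrightarrow> p x = q x"
  shows "dirichlet_inverse \<Omega> p = dirichlet_inverse \<Omega> q"
proof -
  have "(AE x in lebesgue_on \<Omega>. f x = - g x + complex_of_real (p x) * u x) \<longleftrightarrow>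
      (AE x in lebesgue_on \<Omega>. f x = - g x + complex_of_real (q x) * u x)" for f g u
    using assms(2) by (intro AE_cong) simp
  then have "dirichlet_realization \<Omega> p = dirichlet_realization \<Omega> q"
    by (intro ext) (simp add: dirichlet_realization_def)
  then show ?thesis by (intro ext) (simp add: dirichlet_inverse_def)
qed

theorem corollary5p7:
  fixes \<Omega> :: "(real ^ 'n) set" and q q1 q2 :: "real ^ 'n \<Rightarrow> real" and \<tau> :: real
  assumes "CARD('n) \<ge> 2"
    and "smooth_bounded_domain \<Omega>"
    and "smooth_on_closure \<Omega> q" and "smooth_on_closure \<Omega> q1" and "smooth_on_closure \<Omega> q2"
    and "\<forall>x\<in>closure \<Omega>. q x \<ge> 0" and "\<forall>x\<in>closure \<Omega>. q1 x \<ge> 0" and "\<forall>x\<in>closure \<Omega>. q2 x \<ge> 0"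
    and "0 < \<tau>" and "\<tau> < 1"
    and "\<forall>f\<in>L2 \<Omega>. AE x in lebesgue_on \<Omega>.
           dirichlet_inverse \<Omega> q f x =
             complex_of_real \<tau> * dirichlet_inverse \<Omega> q1 f x
             + complex_of_real (1 - \<tau>) * dirichlet_inverse \<Omega> q2 f x"
  shows "\<forall>x\<in>\<Omega>. q x = q1 x \<and> q1 x = q2 x"
proof
  fix y assume y: "y \<in> \<Omega>"
  interpret bounded_open_set \<Omega>
    using assms(2) by unfold_locales (auto simp: smooth_bounded_domain_def)
  note sub = subsetD[OF closure_subset[of \<Omega>]]
  obtain Q where Q: "smooth_on UNIV Q" "\<And>x. x \<in> \<Omega> \<Longrightarrow> Q x = q x"
    using assms(3) sub unfolding smooth_on_closure_def by blast
  obtain Q1 where Q1: "smooth_on UNIV Q1" "\<And>x. x \<in> \<Omega> \<Longrightarrow> Q1 x = q1 x"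
    using assms(4) sub unfolding smooth_on_closure_def by blast
  obtain Q2 where Q2: "smooth_on UNIV Q2" "\<And>x. x \<in> \<Omega> \<Longrightarrow> Q2 x = q2 x"
    using assms(5) sub unfolding smooth_on_closure_def by blast
  have G: "dirichlet_inverse \<Omega> q = dirichlet_inverse \<Omega> Q" "dirichlet_inverse \<Omega> q1 = dirichlet_inverse \<Omega> Q1"
    "dirichlet_inverse \<Omega> q2 = dirichlet_inverse \<Omega> Q2"
    using Q(2) Q1(2) Q2(2) by (auto intro!: dirichlet_inverse_cong[OF open_set])
  have pos: "\<forall>x\<in>\<Omega>. Q x \<ge> 0" "\<forall>x\<in>\<Omega>. Q1 x \<ge> 0" "\<forall>x\<in>\<Omega>. Q2 x \<ge> 0"
    using assms(6-8) sub Q(2) Q1(2) Q2(2) by auto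
  have conv: "AE x in M. dirichlet_inverse \<Omega> Q f x = complex_of_real \<tau> * dirichlet_inverse \<Omega> Q1 f x
      + complex_of_real (1 - \<tau>) * dirichlet_inverse \<Omega> Q2 f x" if "f \<in> L2 \<Omega>" for f
    using assms(11) that unfolding G by blast
  \<comment> \<open>The coefficient is kept as 1 - (1 - \<tau>) to match the hypothesis with \<tau>
    replaced by 1 - \<tau> and the two potentials exchanged.\<close>
  have conv': "AE x in M. dirichlet_inverse \<Omega> Q f x = complex_of_real (1 - \<tau>) * dirichlet_inverse \<Omega> Q2 f x
      + complex_of_real (1 - (1 - \<tau>)) * dirichlet_inverse \<Omega> Q1 f x" if "f \<in> L2 \<Omega>" for f
    using conv[OF that] by eventually_elim (simp add: add.commute)
  have "Q y = Q2 y"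
    by (rule convex_combination_potential_eq[OF Q(1) Q1(1) Q2(1) pos assms(9,10) conv y])
  moreover have "Q y = Q1 y"
    by (rule convex_combination_potential_eq[OF Q(1) Q2(1) Q1(1) pos(1,3,2) _ _ conv' y])
      (use assms(9,10) in auto)
  ultimately show "q y = q1 y \<and> q1 y = q2 y" using Q(2) Q1(2) Q2(2) y by auto
qed

end
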